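(* For every constant $C>0$ there is a constant $c>0$ (depending only on $C$) such that for every prime $p$ and every multiplicative subgroup $\Gamma\subseteq\mathbb{F}_p^*$ with $2\le|\Gamma|\le C\sqrt p$, $$|\Gamma+\Gamma|\ge c\,\frac{|\Gamma|^{\frac85}}{\log^{\frac35}|\Gamma|}.$$
   Context: $\mathbb{F}_p=\mathbb{Z}/p\mathbb{Z}$, $\mathbb{F}_p^*=\mathbb{F}_p\setminus\{0\}$, and $\Gamma+\Gamma=\{a+b:a,b\in\Gamma\}$. Logarithms are to base $2$. *)

theory Defs
  imports Complex_Main "HOL-Number_Theory.Number_Theory"
begin

end

theory Submission
  imports Defs "HOL-Computational_Algebra.Computational_Algebra"
    "HOL-Analysis.Convex" "HOL-Analysis.Harmonic_Numbers"
begin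

text \<open>
  Write $n$ for the order of the subgroup $G$, $S = G + G$, and let $r(u)$ be the number of
  representations $u = b - d$ in $G$. By Cauchy--Schwarz the energy
  $E = \sum_{a, c \in G} r(a - c)$ is at least $n^4 / |S|$, so it suffices to show
  $E = O(n^{4/3} |S|^{2/3} \log n)$.

  Stepanov's method bounds the number of $x$ for which $(x^n, (x - 1)^n)$ lies in a given set of
  $T$ pairs by $O((n T)^{2/3})$. Group the pairs $(a, c)$ by the ratio $x = (1 + a) / (1 + c)$.
  The fibre over $x$ is a popular pair count, so the number of $x$ with fibre of size at least
  $k$ is $O(n^2 / k^2)$. If $r(a - c) \ge k$, then the $n$-th powers of $x$ and
  $x - 1 = (a - c) / (1 + c)$ are quotients of $n$-th powers of elements of $S$ and of the
  $O(n^2 / k^3)$ values $u^n$ with $r(u) \ge k$; since the elements of $S$ have at most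
  $|S| / n$ different $n$-th powers, there are $O(n^{2/3} |S|^{4/3} / k^2)$ such $x$. Two layer-cake
  sums and Cauchy--Schwarz over $x$ then give the bound on $E$.
\<close>

text \<open>The bounds \<open>n^4 / |S| <= E\<close> and
  \<open>E = O(n^(4/3) |S|^(2/3) log n)\<close> rearrange to
  \<open>|S|^(5/3) >= c n^(8/3) / log n\<close>, whence the exponents 8/5 and 3/5. Each layer-cake
  sum loses a harmonic factor, but Cauchy--Schwarz takes the square root of their product, so
  \<open>E\<close> loses only one logarithm. The obstacle is the range of Stepanov's method: it
  needs \<open>32 T <= n^2\<close> and \<open>32 T n^4 <= p^3\<close>. Sets of up to about
  \<open>n^2\<close> pairs occur, and for these the second condition says
  \<open>n^6 = O(p^3)\<close>, which is the hypothesis \<open>n <= C sqrt p\<close>. The dependence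
  on \<open>C\<close> is carried by a natural number \<open>M\<close> with
  \<open>32 n^6 <= M p^3\<close>: the method covers \<open>T <= n^2 / M\<close>, and larger sets are
  reduced to this range or estimated trivially at the cost of a power of \<open>M\<close>. The ratio
  \<open>(1 + a) / (1 + c)\<close> is chosen because \<open>1\<close> lies in \<open>G\<close>: its
  numerator and denominator are elements of \<open>S\<close>, and subtracting 1 keeps the
  denominator and turns the numerator into \<open>a - c\<close>, whose popularity \<open>E\<close>
  measures. Bounds with exponent 2/3 are stated for cubes, which keeps them in the natural numbers
  until the harmonic sums.\<close>

hide_const (open) UnivPoly.coeff UnivPoly.monom

section \<open>Integer polynomials modulo a prime\<close>

text \<open>Pigeonhole replaces linear algebra: there are more coefficient vectors with entries in
  \<open>{0..<p}\<close> than vectors of residues of the linear forms, so two of them collide and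
  their difference solves the system. It is nontrivial modulo \<open>p\<close> because entries
  differ by less than \<open>p\<close>.\<close>

lemma homogeneous_system_mod:
  fixes p :: int and M :: "'j \<Rightarrow> 'i \<Rightarrow> int"
  assumes p: "p > 1" and fin: "finite I" "finite J" and less: "card J < card I"
  shows "\<exists>l. (\<forall>j\<in>J. p dvd (\<Sum>i\<in>I. l i * M j i)) \<and> (\<exists>i\<in>I. \<not> p dvd l i)"
proof -
  define \<Phi> where "\<Phi> l = (\<lambda>j\<in>J. (\<Sum>i\<in>I. l i * M j i) mod p)" for l
  have "card (J \<rightarrow>\<^sub>E {0..<p}) < card (I \<rightarrow>\<^sub>E {0..<p})"
    using p fin less by (simp add: card_PiE power_strict_increasing)
  moreover have "\<Phi> ` (I \<rightarrow>\<^sub>E {0..<p}) \<subseteq> J \<rightarrow>\<^sub>E {0..<p}"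
    using p by (auto simp: \<Phi>_def)
  ultimately have "\<not> inj_on \<Phi> (I \<rightarrow>\<^sub>E {0..<p})"
    using card_inj_on_le[of \<Phi> "I \<rightarrow>\<^sub>E {0..<p}" "J \<rightarrow>\<^sub>E {0..<p}"] fin by (auto simp: finite_PiE)
  then obtain f g where fg: "f \<in> I \<rightarrow>\<^sub>E {0..<p}" "g \<in> I \<rightarrow>\<^sub>E {0..<p}" "\<Phi> f = \<Phi> g" "f \<noteq> g"
    by (auto simp: inj_on_def)
  show ?thesis
  proof (intro exI[of _ "\<lambda>i. f i - g i"] conjI ballI)
    fix j assume "j \<in> J"
    then have "(\<Sum>i\<in>I. f i * M j i) mod p = (\<Sum>i\<in>I. g i * M j i) mod p"
      using fun_cong[OF fg(3), of j] by (simp add: \<Phi>_def)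
    then show "p dvd (\<Sum>i\<in>I. (f i - g i) * M j i)"
      by (simp add: mod_eq_dvd_iff sum_subtractf left_diff_distrib)
  next
    obtain i where i: "i \<in> I" "f i \<noteq> g i"
      using fg(1,2,4) by (metis PiE_ext)
    then have "f i \<in> {0..<p}" "g i \<in> {0..<p}" using fg by auto
    then have "\<bar>f i - g i\<bar> < p" by auto
    then have "\<not> p dvd f i - g i" using i zdvd_imp_le[of p "\<bar>f i - g i\<bar>"] by auto
    then show "\<exists>i\<in>I. \<not> p dvd f i - g i" using i by blast
  qed
qed

text \<open>
  There is no type of the field with $p$ elements for a variable $p$, so polynomials over it are
  represented by integer polynomials, compared through divisibility by the constant $p$.
\<close>

definition root_mod :: "int \<Rightarrow> int \<Rightarrow> nat \<Rightarrow> int poly \<Rightarrow> bool" where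
  "root_mod p x m f \<longleftrightarrow> (\<exists>q. [:p:] dvd f - [:-x, 1:] ^ m * q)"

lemma root_mod_0 [simp]: "root_mod p x 0 f"
  unfolding root_mod_def by (intro exI[of _ f]) simp

lemma root_mod_mono:
  assumes "root_mod p x m f" "k \<le> m"
  shows "root_mod p x k f"
proof -
  obtain q where "[:p:] dvd f - [:-x, 1:] ^ m * q"
    using assms(1) by (auto simp: root_mod_def)
  then have "[:p:] dvd f - [:-x, 1:] ^ k * ([:-x, 1:] ^ (m - k) * q)"
    using assms(2) by (simp add: power_add[symmetric] mult.assoc[symmetric])
  then show ?thesis by (auto simp: root_mod_def)
qed

lemma root_mod_1_iff: "root_mod p x 1 f \<longleftrightarrow> p dvd poly f x"
proof
  assume "root_mod p x 1 f"
  then obtain q e where "f = [:-x, 1:] * q + [:p:] * e"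
    by (auto simp: root_mod_def dvd_def algebra_simps)
  then show "p dvd poly f x" by simp
next
  assume "p dvd poly f x"
  moreover have "[:-x, 1:] dvd f - [:poly f x:]" by (simp add: poly_eq_0_iff_dvd[symmetric])
  then obtain q where "f - [:poly f x:] = [:-x, 1:] * q" by (rule dvdE)
  then have "f - [:-x, 1:] * q = [:poly f x:]" by (simp add: algebra_simps)
  ultimately have "[:p:] dvd f - [:-x, 1:] ^ 1 * q" by simp
  then show "root_mod p x 1 f" unfolding root_mod_def by blast
qed

lemma prime_elem_const: "prime (p::int) \<Longrightarrow> prime_elem [:p:]"
  by (intro lift_prime_elem_poly prime_imp_prime_elem)

lemma not_const_dvd_linear_power:
  fixes p :: int
  assumes "prime p" shows "\<not> [:p:] dvd [:-x, 1:] ^ m"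
proof
  assume "[:p:] dvd [:-x, 1:] ^ m"
  then have "[:p:] dvd [:-x, 1:]"
    using prime_elem_dvd_power prime_elem_const[OF assms] by blast
  then have "p dvd 1" by (auto simp: const_poly_dvd_iff dest: spec[of _ 1])
  then show False using assms by (simp add: not_prime_unit)
qed

text \<open>Orders of vanishing modulo \<open>p\<close> are gained one at a time: once
  \<open>q\<close> is \<open>(X - x)^D * q'\<close> modulo \<open>p\<close>, that power cancels
  because the constant \<open>p\<close> is a prime element of the polynomial ring. What remains says
  that \<open>M * q'\<close> vanishes at \<open>x\<close>, so \<open>q'\<close> does.\<close>

lemma root_mod_mult_cancel:
  fixes p :: int
  assumes p: "prime p" and M: "\<not> p dvd poly M x" and f: "root_mod p x D (M * q)"
  shows "root_mod p x D q"
  using f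
proof (induction D)
  case (Suc D)
  let ?L = "[:-x, 1:]"
  obtain s where s: "[:p:] dvd M * q - ?L ^ Suc D * s"
    using Suc.prems by (auto simp: root_mod_def)
  obtain q' where q': "[:p:] dvd q - ?L ^ D * q'"
    using Suc.IH root_mod_mono[OF Suc.prems, of D] by (auto simp: root_mod_def)
  have "[:p:] dvd (M * q - ?L ^ Suc D * s) - M * (q - ?L ^ D * q')"
    by (intro dvd_diff dvd_mult s q')
  also have "\<dots> = ?L ^ D * (M * q' - ?L ^ 1 * s)" by (simp add: algebra_simps)
  finally have "[:p:] dvd M * q' - ?L ^ 1 * s"
    using prime_elem_dvd_mult_iff[OF prime_elem_const[OF p]] not_const_dvd_linear_power[OF p]
    by blast
  then have "root_mod p x 1 (M * q')" unfolding root_mod_def by blast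
  then have "p dvd poly M x * poly q' x" unfolding root_mod_1_iff by simp
  then have "root_mod p x 1 q'" using M p unfolding root_mod_1_iff by (simp add: prime_dvd_mult_iff)
  then obtain r where r: "[:p:] dvd q' - ?L * r" by (auto simp: root_mod_def)
  have "[:p:] dvd (q - ?L ^ D * q') + ?L ^ D * (q' - ?L * r)"
    by (intro dvd_add dvd_mult q' r)
  also have "\<dots> = q - ?L ^ Suc D * r" by (simp add: algebra_simps)
  finally show ?case unfolding root_mod_def by blast
qed simp

text \<open>Modulo \<open>p\<close>, a nonzero multiple of a monic polynomial has at least its
  degree. The integer cofactor \<open>q\<close> may have top terms that vanish modulo
  \<open>p\<close>; the induction strips them one by one, since \<open>f\<close> has no coefficient
  in degree \<open>degree M + degree q\<close>.\<close>

lemma const_dvd_if_degree_less: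
  fixes p :: int
  assumes "lead_coeff M = 1" "degree f < degree M" "[:p:] dvd f - M * q"
  shows "[:p:] dvd f"
  using assms(3)
proof (induction "degree q" arbitrary: q rule: less_induct)
  case less
  show ?case
  proof (cases "q = 0")
    case False
    let ?m = "monom (lead_coeff q) (degree q)"
    have "p dvd coeff (f - M * q) (degree M + degree q)"
      using less.prems by (simp add: const_poly_dvd_iff)
    moreover have "coeff f (degree M + degree q) = 0"
      using assms(2) by (intro coeff_eq_0) simp
    ultimately have "p dvd lead_coeff q"
      using assms(1) by (simp add: coeff_mult_degree_sum)
    then have pm: "[:p:] dvd ?m" by (simp add: const_poly_dvd_iff)
    have "[:p:] dvd (f - M * q) + M * ?m" by (intro dvd_add less.prems dvd_mult pm)
    also have "\<dots> = f - M * (q - ?m)" by (simp add: algebra_simps)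
    finally have *: "[:p:] dvd f - M * (q - ?m)" .
    show ?thesis
    proof (cases "degree q = 0")
      case True
      then have "q = ?m" by (metis degree_0_id monom_0 degree_eq_zeroE lead_coeff_pCons(2) coeff_pCons_0)
      then show ?thesis using * by simp
    next
      case False
      have "degree (q - ?m) \<le> degree q"
        by (intro degree_diff_le degree_monom_le) simp
      moreover have "coeff (q - ?m) (degree q) = 0" by simp
      ultimately have "degree (q - ?m) < degree q"
        using False by (metis degree_0 leading_coeff_0_iff nat_less_le)
      then show ?thesis using less.hyps * by blast
    qed
  qed (use less.prems in simp)
qed

text \<open>Distinct elements of \<open>{0..<p}\<close> are incongruent, so the factors
  \<open>(X - x)^D\<close> can be split off in turn. Their product is monic of degree
  \<open>D * card X\<close> and divides \<open>f\<close> modulo \<open>p\<close>.\<close>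

lemma multiplicity_count_mod:
  fixes p :: int
  assumes p: "prime p" and X: "X \<subseteq> {0..<p}" and f: "\<not> [:p:] dvd f"
    and root: "\<And>x. x \<in> X \<Longrightarrow> root_mod p x D f"
  shows "D * card X \<le> degree f"
proof -
  have "finite X" using X finite_subset by blast
  then have "\<exists>q. [:p:] dvd f - (\<Prod>x\<in>X. [:-x, 1:] ^ D) * q"
    using X root
  proof (induction X rule: finite_induct)
    case empty
    show ?case by (intro exI[of _ f]) simp
  next
    case (insert x X)
    let ?M = "\<Prod>x\<in>X. [:-x, 1:] ^ D"
    obtain q where q: "[:p:] dvd f - ?M * q" using insert by auto
    obtain s where s: "[:p:] dvd f - [:-x, 1:] ^ D * s"
      using insert.prems(2)[of x] by (auto simp: root_mod_def)
    have "[:p:] dvd (f - [:-x, 1:] ^ D * s) - (f - ?M * q)" by (intro dvd_diff q s)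
    then have root_q: "root_mod p x D (?M * q)"
      unfolding root_mod_def by (intro exI[of _ s]) (simp add: algebra_simps)
    have "\<not> p dvd poly ?M x"
    proof
      assume "p dvd poly ?M x"
      then obtain y where y: "y \<in> X" "p dvd (x - y) ^ D"
        using p insert.hyps(1) by (auto simp: poly_prod prime_dvd_prod_iff)
      then have "p dvd x - y" using p prime_dvd_power by blast
      then have "x mod p = y mod p" by (simp add: mod_eq_dvd_iff)
      moreover have "x \<in> {0..<p}" "y \<in> {0..<p}" using y insert.prems(1) by auto
      ultimately show False using y insert.hyps(2) by auto
    qed
    then have "root_mod p x D q" using root_q by (rule root_mod_mult_cancel[OF p])
    then obtain r where r: "[:p:] dvd q - [:-x, 1:] ^ D * r" by (auto simp: root_mod_def)
    have "[:p:] dvd (f - ?M * q) + ?M * (q - [:-x, 1:] ^ D * r)" by (intro dvd_add dvd_mult q r)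
    also have "\<dots> = f - (\<Prod>x\<in>insert x X. [:-x, 1:] ^ D) * r"
      using insert.hyps by (simp add: algebra_simps)
    finally show ?case by blast
  qed
  then obtain q where q: "[:p:] dvd f - (\<Prod>x\<in>X. [:-x, 1:] ^ D) * q" by blast
  have lc: "lead_coeff (\<Prod>x\<in>X. [:-x, 1:] ^ D) = 1"
    by (simp add: lead_coeff_prod lead_coeff_power)
  have "degree (\<Prod>x\<in>X. [:-x, 1:] ^ D) = (\<Sum>x\<in>X. degree ([:-x, 1:] ^ D))"
    by (intro degree_prod_eq_sum_degree) auto
  also have "\<dots> = D * card X" by (simp add: degree_linear_power)
  finally show ?thesis using const_dvd_if_degree_less[OF lc _ q] f by fastforce
qed

lemma higher_pderiv_pcompose_translate:
  fixes f :: "int poly"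
  shows "(pderiv ^^ k) (pcompose f [:x, 1:]) = pcompose ((pderiv ^^ k) f) [:x, 1:]"
proof (induction k)
  case (Suc k)
  have "(pderiv ^^ Suc k) (pcompose f [:x, 1:]) = pderiv (pcompose ((pderiv ^^ k) f) [:x, 1:])"
    using Suc by simp
  also have "\<dots> = pcompose (pderiv ((pderiv ^^ k) f)) [:x, 1:] * pderiv [:x, 1:]"
    by (rule pderiv_pcompose)
  also have "pderiv [:x, 1:] = 1" by (simp add: pderiv_pCons)
  finally show ?case by simp
qed simp

lemma pcompose_power:
  fixes f g :: "'a::comm_semiring_1 poly"
  shows "pcompose (f ^ n) g = pcompose f g ^ n"
  by (induction n) (simp_all add: pcompose_mult pcompose_1)

text \<open>Taylor expansion at \<open>x\<close>: the coefficient of degree \<open>k\<close> of the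
  translate \<open>g\<close>, multiplied by \<open>k!\<close>, is the \<open>k\<close>-th derivative
  of \<open>f\<close> at \<open>x\<close>. The bound on \<open>D\<close> makes \<open>k!\<close>
  invertible modulo \<open>p\<close> for all \<open>k < D\<close>; beyond that range derivatives no
  longer detect the order of vanishing.\<close>

lemma root_mod_if_higher_pderiv:
  fixes p :: int
  assumes p: "prime p" and D: "int D \<le> p"
    and der: "\<And>k. k < D \<Longrightarrow> p dvd poly ((pderiv ^^ k) f) x"
  shows "root_mod p x D f"
proof -
  define g where "g = pcompose f [:x, 1:]"
  have cutoff: "[:p:] dvd poly_cutoff D g"
    unfolding const_poly_dvd_iff
  proof
    fix k
    show "p dvd coeff (poly_cutoff D g) k"
    proof (cases "k < D")
      case True
      have "coeff ((pderiv ^^ k) g) 0 = fact k * coeff g k"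
        unfolding coeff_higher_pderiv by (simp add: pochhammer_fact[symmetric])
      moreover have "coeff ((pderiv ^^ k) g) 0 = poly ((pderiv ^^ k) f) x"
        unfolding g_def higher_pderiv_pcompose_translate
        by (simp add: poly_0_coeff_0[symmetric] poly_pcompose)
      ultimately have "p dvd fact k * coeff g k" using der[OF True] by simp
      moreover have "\<not> p dvd fact k"
      proof
        assume "p dvd fact k"
        then have "int (nat p) dvd int (fact k)" using p prime_gt_0_int[of p] by simp
        then have "nat p dvd fact k" using int_dvd_int_iff by blast
        then have "nat p \<le> k" using p prime_dvd_fact_iff[of "nat p" k] by simp
        then show False using True D by linarith
      qed
      ultimately show ?thesis using p True by (simp add: prime_dvd_mult_iff coeff_poly_cutoff)
    qed (simp add: coeff_poly_cutoff)
  qed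
  have X: "pcompose (monom 1 D) [:-x, 1:] = [:-x, 1:] ^ D"
    by (simp add: monom_altdef pcompose_power pcompose_pCons)
  have "g = poly_cutoff D g + monom 1 D * poly_shift D g"
    by (intro poly_eqI) (simp add: coeff_poly_cutoff coeff_poly_shift coeff_monom_mult)
  then have "pcompose g [:-x, 1:] = pcompose (poly_cutoff D g) [:-x, 1:]
      + [:-x, 1:] ^ D * pcompose (poly_shift D g) [:-x, 1:]"
    by (metis pcompose_add pcompose_mult X)
  moreover have "pcompose g [:-x, 1:] = f"
    unfolding g_def by (simp add: pcompose_assoc[symmetric] pcompose_pCons)
  moreover obtain e where "poly_cutoff D g = [:p:] * e" using cutoff by (rule dvdE)
  then have "[:p:] dvd pcompose (poly_cutoff D g) [:-x, 1:]"
    by (simp add: pcompose_smult const_poly_dvd_iff)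
  ultimately show ?thesis
    unfolding root_mod_def by (intro exI[of _ "pcompose (poly_shift D g) [:-x, 1:]"]) simp
qed

section \<open>Stepanov's method\<close>

text \<open>The operator $f \mapsto X f' - i f$ removes the monomial of degree $i$, and costs only one
  order of vanishing at $1$.\<close>

lemma root_mod_1_sparse:
  fixes p :: int
  assumes "prime p" "finite I" "\<And>e. e \<in> I \<Longrightarrow> int e < p"
    and "root_mod p 1 (card I) (\<Sum>e\<in>I. monom (c e) e)" "e \<in> I"
  shows "p dvd c e"
  using assms(2-)
proof (induction I arbitrary: c e rule: finite_induct)
  case (insert i I)
  let ?f = "\<Sum>e\<in>insert i I. monom (c e) e" and ?L = "[:-1, 1:] :: int poly"
  define q0 where "q0 f = [:0, 1:] * pderiv f - of_nat i * f" for f :: "int poly"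
  obtain q r where q: "?f - ?L ^ Suc (card I) * q = [:p:] * r"
    using insert.prems(2) insert.hyps by (auto simp: root_mod_def elim: dvdE)
  then have f: "?f = ?L ^ Suc (card I) * q + [:p:] * r" by (simp add: algebra_simps)
  have "q0 (?L ^ Suc (card I) * q + [:p:] * r) =
      ?L ^ card I * ([:0, 1:] * (of_nat (Suc (card I)) * q + ?L * pderiv q) - of_nat i * ?L * q)
      + [:p:] * q0 r"
    unfolding q0_def pderiv_add pderiv_mult pderiv_power_Suc
    by (simp add: pderiv_pCons algebra_simps of_nat_poly)
  then have "q0 ?f = ?L ^ card I * ([:0, 1:] * (of_nat (Suc (card I)) * q + ?L * pderiv q) - of_nat i * ?L * q)
      + [:p:] * q0 r" using f by simp
  then have "root_mod p 1 (card I) (q0 ?f)"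
    unfolding root_mod_def
    by (intro exI[of _ "[:0, 1:] * (of_nat (Suc (card I)) * q + ?L * pderiv q) - of_nat i * ?L * q"])
      (simp only: add_diff_cancel_left' dvd_triv_left)
  moreover have "q0 ?f = (\<Sum>e\<in>I. monom (c e * (int e - int i)) e)"
  proof -
    have q0_sum: "q0 (sum g E) = (\<Sum>e\<in>E. q0 (g e))" for g and E :: "nat set"
      unfolding q0_def
      by (induction E rule: infinite_finite_induct) (simp_all add: pderiv_add algebra_simps)
    have mon: "q0 (monom a e) = monom (a * (int e - int i)) e" for a e
      by (intro poly_eqI) (auto simp: q0_def pderiv_monom coeff_pCons of_nat_poly algebra_simps split: nat.splits)
    show ?thesis unfolding q0_sum mon using insert.hyps by simp
  qed
  ultimately have dvd: "p dvd c e * (int e - int i)" if "e \<in> I" for e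
    using insert.IH[of "\<lambda>e. c e * (int e - int i)" e] insert.prems(1) that by simp
  have ce: "p dvd c e" if "e \<in> I" for e
  proof -
    have "\<bar>int e - int i\<bar> < p" "int e \<noteq> int i"
      using insert.prems(1)[of e] insert.prems(1)[of i] insert.hyps(2) that by auto
    then have "\<not> p dvd int e - int i" using zdvd_imp_le[of p "\<bar>int e - int i\<bar>"] by auto
    then show ?thesis using dvd[OF that] assms(1) by (simp add: prime_dvd_mult_iff)
  qed
  \<comment> \<open>The operator has annihilated the term of exponent \<open>i\<close>, so
    \<open>c i\<close> is recovered from the value at 1, which is the sum of all
    coefficients.\<close>
  have "root_mod p 1 1 ?f"
    using insert.prems(2) insert.hyps by (intro root_mod_mono[OF insert.prems(2)]) simp
  then have "p dvd c i + (\<Sum>e\<in>I. c e)"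
    unfolding root_mod_1_iff using insert.hyps by (simp add: poly_sum poly_monom)
  then have "p dvd c i" using ce dvd_sum[of I p c] by (simp add: dvd_add_left_iff)
  then show ?case using ce insert.prems(3) by auto
qed simp

text \<open>What is left of the $k$-th derivative of $f X^u (X - 1)^v$ after the factor
  $X^{u - k} (X - 1)^{v - k}$ has been taken out.\<close>

primrec deriv_factor :: "nat \<Rightarrow> nat \<Rightarrow> nat \<Rightarrow> int poly \<Rightarrow> int poly" where
  "deriv_factor u v 0 f = f"
| "deriv_factor u v (Suc k) f = [:0, 1:] * [:-1, 1:] * pderiv (deriv_factor u v k f)
     + ((of_nat u - of_nat k) * [:-1, 1:] + (of_nat v - of_nat k) * [:0, 1:]) * deriv_factor u v k f"

text \<open>The extra factor \<open>q\<close> avoids the exponent \<open>k - 1\<close>, which is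
  truncated at \<open>k = 0\<close>.\<close>

lemma mult_pderiv_power:
  fixes q :: "'a::idom poly"
  shows "q * pderiv (q ^ k) = of_nat k * q ^ k * pderiv q"
proof (induction k)
  case (Suc k)
  have "q * pderiv (q ^ Suc k) = q * (q * pderiv (q ^ k)) + q * (q ^ k * pderiv q)"
    by (simp add: pderiv_mult algebra_simps)
  then show ?case unfolding Suc by (simp add: algebra_simps)
qed simp

text \<open>Clearing the denominator \<open>X^k (X - 1)^k\<close> keeps the identity inside integer
  polynomials also when \<open>k\<close> exceeds \<open>u\<close> or \<open>v\<close>, as happens
  for the terms with \<open>b = 0\<close> or \<open>c = 0\<close> below. The recursion of
  \<open>deriv_factor\<close> is what differentiating this identity and multiplying by
  \<open>X (X - 1)\<close> produces.\<close>

lemma higher_pderiv_deriv_factor: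
  fixes f :: "int poly"
  shows "(pderiv ^^ k) (f * ([:0, 1:] ^ u * [:-1, 1:] ^ v)) * ([:0, 1:] ^ k * [:-1, 1:] ^ k)
    = [:0, 1:] ^ u * [:-1, 1:] ^ v * deriv_factor u v k f"
proof (induction k)
  case (Suc k)
  define X Y :: "int poly" where "X = [:0, 1:]" and "Y = [:-1, 1:]"
  define F where "F = (pderiv ^^ k) (f * (X ^ u * Y ^ v))"
  define g where "g = deriv_factor u v k f"
  have P: "X * Y * pderiv (X ^ m * Y ^ j) = X ^ m * Y ^ j * (of_nat m * Y + of_nat j * X)" for m j
  proof -
    have "X * Y * pderiv (X ^ m * Y ^ j) = X * pderiv (X ^ m) * (Y * Y ^ j) + Y * pderiv (Y ^ j) * (X * X ^ m)"
      by (simp add: pderiv_mult algebra_simps)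
    moreover have "pderiv X = 1" "pderiv Y = 1" by (simp_all add: X_def Y_def pderiv_pCons)
    ultimately show ?thesis unfolding mult_pderiv_power by (simp add: algebra_simps)
  qed
  have IH: "F * (X ^ k * Y ^ k) = X ^ u * Y ^ v * g"
    using Suc by (simp add: F_def X_def Y_def g_def)
  have "pderiv (F * (X ^ k * Y ^ k)) = pderiv (X ^ u * Y ^ v * g)" using IH by simp
  then have "pderiv F * (X ^ k * Y ^ k) + F * pderiv (X ^ k * Y ^ k)
      = X ^ u * Y ^ v * pderiv g + pderiv (X ^ u * Y ^ v) * g"
    by (simp only: pderiv_mult[of F] pderiv_mult[of "X ^ u * Y ^ v" g])
      (simp only: mult.commute add.commute)
  then have "X * Y * (pderiv F * (X ^ k * Y ^ k) + F * pderiv (X ^ k * Y ^ k))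
      = X * Y * (X ^ u * Y ^ v * pderiv g + pderiv (X ^ u * Y ^ v) * g)" by simp
  then have "pderiv F * (X ^ Suc k * Y ^ Suc k) + F * (X * Y * pderiv (X ^ k * Y ^ k))
      = X ^ u * Y ^ v * (X * Y * pderiv g) + X * Y * pderiv (X ^ u * Y ^ v) * g"
    by (simp add: algebra_simps)
  moreover have "F * (X * Y * pderiv (X ^ k * Y ^ k)) = X ^ u * Y ^ v * g * (of_nat k * Y + of_nat k * X)"
    unfolding P IH[symmetric] by (simp add: algebra_simps)
  ultimately have "pderiv F * (X ^ Suc k * Y ^ Suc k)
      = X ^ u * Y ^ v * (X * Y * pderiv g + ((of_nat u - of_nat k) * Y + (of_nat v - of_nat k) * X) * g)"
    unfolding P by (simp add: algebra_simps)
  then show ?case by (simp add: F_def X_def Y_def g_def del: power_Suc)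
qed simp

text \<open>The bound is independent of \<open>u\<close> and \<open>v\<close>. This is what makes
  Stepanov's method economical: with \<open>x^n\<close> and \<open>(x - 1)^n\<close> fixed, a
  derivative of a term of degree of order \<open>n * B\<close> is governed by a polynomial of degree
  only \<open>a + k\<close>.\<close>

lemma degree_deriv_factor: "degree (deriv_factor u v k f) \<le> degree f + k"
proof (induction k)
  case (Suc k)
  let ?g = "deriv_factor u v k f"
  have "degree ([:0, 1:] * [:-1, 1:] * pderiv ?g) \<le> degree f + Suc k"
  \<comment> \<open>For constant \<open>?g\<close> the truncated \<open>degree ?g - 1\<close> would
    leave the bound 2, one too many when \<open>k\<close> and \<open>degree f\<close> are 0; but
    then the derivative is zero.\<close>
  proof (cases "degree ?g = 0")
    case False
    have "degree ([:0, 1:] * [:-1, 1:] * pderiv ?g) \<le> degree ([:0, 1:] * [:-1, 1:] :: int poly) + degree (pderiv ?g)"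
      by (rule degree_mult_le)
    also have "\<dots> \<le> 2 + (degree ?g - 1)"
      by (intro add_mono) (simp_all add: degree_pderiv)
    finally show ?thesis using Suc False by simp
  qed (simp add: pderiv_eq_0_iff[THEN iffD2])
  moreover have "degree (((of_nat u - of_nat k) * [:-1, 1:] + (of_nat v - of_nat k) * [:0, 1:]) * ?g)
      \<le> degree f + Suc k"
  proof -
    have "degree ((of_nat u - of_nat k) * [:-1, 1:] + (of_nat v - of_nat k) * [:0, 1:] :: int poly) \<le> 1"
      unfolding of_nat_poly diff_pCons by (intro degree_add_le order.trans[OF degree_mult_le]) auto
    then show ?thesis using Suc by (intro order.trans[OF degree_mult_le]) simp
  qed
  ultimately show ?case by (simp only: deriv_factor.simps degree_add_le)
qed simp

text \<open>After division by the lowest occurring power of $(X - 1)^n$, a zero polynomial would make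
  the lowest block, which has at most $A B \le n$ terms, divisible by $(X - 1)^n$.\<close>

lemma auxiliary_poly_nonzero_mod:
  fixes p :: int and l :: "nat \<Rightarrow> nat \<Rightarrow> nat \<Rightarrow> int"
  assumes p: "prime p" and AB: "A * B \<le> n" and nB: "int (n * B) \<le> p"
    and l: "a0 < A" "b0 < B" "c1 < B" "\<not> p dvd l a0 b0 c1"
  shows "\<not> [:p:] dvd (\<Sum>c<B. [:-1, 1:] ^ (n * c) * (\<Sum>b<B. \<Sum>a<A. monom (l a b c) (a + n * b)))"
proof
  let ?Y = "[:-1, 1:] :: int poly"
  define g where "g c = (\<Sum>b<B. \<Sum>a<A. monom (l a b c) (a + n * b))" for c
  assume "[:p:] dvd (\<Sum>c<B. ?Y ^ (n * c) * (\<Sum>b<B. \<Sum>a<A. monom (l a b c) (a + n * b)))"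
  then have dvd: "[:p:] dvd (\<Sum>c<B. ?Y ^ (n * c) * g c)" by (simp only: g_def)
  define P where "P c \<longleftrightarrow> (\<exists>a<A. \<exists>b<B. \<not> p dvd l a b c)" for c
  define c0 where "c0 = (LEAST c. P c)"
  have Pc1: "P c1" using l by (auto simp: P_def)
  have Pc0: "P c0" unfolding c0_def using Pc1 by (rule LeastI)
  have "c0 \<le> c1" unfolding c0_def using Pc1 by (rule Least_le)
  then have c0: "c0 < B" using l(3) by simp
  have least: "\<not> P c" if "c < c0" for c
    using that unfolding c0_def by (rule not_less_Least)
  define h where "h = (\<Sum>c\<in>{Suc c0..<B}. ?Y ^ (n * (c - Suc c0)) * g c)"
  have low: "[:p:] dvd (\<Sum>c<c0. ?Y ^ (n * c) * g c)"
  proof (intro dvd_sum dvd_mult)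
    fix c assume "c \<in> {..<c0}"
    then have "\<not> P c" using least by simp
    then show "[:p:] dvd g c"
      unfolding g_def by (intro dvd_sum) (auto simp: P_def const_poly_dvd_iff)
  qed
  have "(\<Sum>c<B. ?Y ^ (n * c) * g c) =
      (\<Sum>c<c0. ?Y ^ (n * c) * g c) + (\<Sum>c\<in>{c0..<B}. ?Y ^ (n * c) * g c)"
    unfolding lessThan_atLeast0 using c0 by (intro sum.atLeastLessThan_concat[symmetric]) simp_all
  also have "(\<Sum>c\<in>{c0..<B}. ?Y ^ (n * c) * g c) =
      ?Y ^ (n * c0) * g c0 + (\<Sum>c\<in>{Suc c0..<B}. ?Y ^ (n * c) * g c)"
    using c0 by (simp only: sum.atLeast_Suc_lessThan)
  also have "(\<Sum>c\<in>{Suc c0..<B}. ?Y ^ (n * c) * g c) = ?Y ^ (n * c0) * (?Y ^ n * h)"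
    unfolding h_def sum_distrib_left
  proof (intro sum.cong refl)
    fix c assume "c \<in> {Suc c0..<B}"
    then obtain d where "c = Suc c0 + d" using le_Suc_ex[of "Suc c0" c] by auto
    then have "n * c = n * c0 + (n + n * (c - Suc c0))" by (simp add: algebra_simps)
    then show "?Y ^ (n * c) * g c = ?Y ^ (n * c0) * (?Y ^ n * (?Y ^ (n * (c - Suc c0)) * g c))"
      by (simp only: power_add mult.assoc)
  qed
  finally have "(\<Sum>c<B. ?Y ^ (n * c) * g c) = (\<Sum>c<c0. ?Y ^ (n * c) * g c)
      + ?Y ^ (n * c0) * (g c0 + ?Y ^ n * h)" by (simp only: distrib_left)
  then have "[:p:] dvd ?Y ^ (n * c0) * (g c0 + ?Y ^ n * h)"
    using dvd dvd_add_right_iff[OF low] by simp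
  then have "[:p:] dvd g c0 + ?Y ^ n * h"
    using prime_elem_dvd_mult_iff[OF prime_elem_const[OF p]] not_const_dvd_linear_power[OF p, of 1]
    by blast
  then have "root_mod p 1 n (g c0)"
    unfolding root_mod_def by (intro exI[of _ "- h"]) simp
  then have root: "root_mod p 1 (A * B) (g c0)" using AB by (rule root_mod_mono)
  have An: "A \<le> n" using AB l(2) by (metis One_nat_def Suc_leI le_trans less_nat_zero_code mult_le_mono2 nat_mult_1_right not_gr_zero)
  \<comment> \<open>Since \<open>A <= n\<close>, the exponents \<open>a + n * b\<close> are pairwise
    distinct and are decoded by \<open>mod\<close> and \<open>div\<close>. The block is thus a
    sparse polynomial with exactly as many exponents as the order of its zero at 1, all below
    \<open>n * B <= p\<close>.\<close>
  define I where "I = (\<lambda>(a, b). a + n * b) ` ({..<A} \<times> {..<B})"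
  have inj: "inj_on (\<lambda>(a, b). a + n * b) ({..<A} \<times> {..<B})"
  proof (rule inj_onI, clarsimp)
    fix a b a' b' assume *: "a < A" "a' < A" "a + n * b = a' + n * b'"
    have md: "(s + n * t) mod n = s \<and> (s + n * t) div n = t" if "s < A" for s t
      using that An by simp
    show "a = a' \<and> b = b'" using md[OF *(1), of b] md[OF *(2), of b'] *(3) by simp
  qed
  have "g c0 = (\<Sum>(a, b)\<in>{..<A} \<times> {..<B}. monom (l a b c0) (a + n * b))"
    unfolding g_def by (subst sum.swap) (simp add: sum.cartesian_product)
  also have "\<dots> = (\<Sum>e\<in>I. monom (l (e mod n) (e div n) c0) e)"
    unfolding I_def sum.reindex[OF inj] using An by (intro sum.cong) auto
  finally have g: "g c0 = (\<Sum>e\<in>I. monom (l (e mod n) (e div n) c0) e)" .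
  have card: "card I = A * B" unfolding I_def by (simp add: card_image[OF inj])
  have Ip: "int e < p" if "e \<in> I" for e
  proof -
    obtain a b where e: "e = a + n * b" "a < A" "b < B" using \<open>e \<in> I\<close> by (auto simp: I_def)
    then have "e < n + n * b" using An by simp
    also have "\<dots> \<le> n * B" using e(3) by (metis Suc_leI mult_Suc_right mult_le_mono2)
    finally show ?thesis using nB by linarith
  qed
  obtain a b where ab: "a < A" "b < B" "\<not> p dvd l a b c0" using Pc0 by (auto simp: P_def)
  have "a + n * b \<in> I" using ab by (auto simp: I_def)
  then have "p dvd l ((a + n * b) mod n) ((a + n * b) div n) c0"
    using root_mod_1_sparse[OF p _ Ip, of I "\<lambda>e. l (e mod n) (e div n) c0" "a + n * b"] root g card
    by (simp add: I_def)
  then show False using ab An by simp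
qed

text \<open>The points 0 and 1 are left out because derivatives are computed only up to the factor
  \<open>X^k (X - 1)^k\<close>, which must be invertible at the point.\<close>

definition power_pair_points :: "int \<Rightarrow> nat \<Rightarrow> (int \<times> int) set \<Rightarrow> int set" where
  "power_pair_points p n K = {x \<in> {2..<p}. (x ^ n mod p, (x - 1) ^ n mod p) \<in> K}"

lemma poly_eq_sum_coeff:
  fixes f :: "'a::comm_semiring_1 poly"
  assumes "degree f < N"
  shows "poly f x = (\<Sum>i<N. coeff f i * x ^ i)"
  unfolding poly_altdef using assms
  by (intro sum.mono_neutral_left) (auto simp: coeff_eq_0)

text \<open>An integer substitute for the cube root of \<open>m\<close>, rounded up; the 8 comes
  from \<open>B <= 2 * (B - 1)\<close>.\<close>

lemma cube_root_parameter:
  fixes m :: nat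
  assumes "m > 1"
  obtains B where "B \<ge> 2" "m \<le> B ^ 3" "B ^ 3 < 8 * m"
proof -
  define B where "B = (LEAST B. m \<le> B ^ 3)"
  have "m \<le> m ^ 3" by (cases m) (simp_all add: power3_eq_cube)
  then have B: "m \<le> B ^ 3" unfolding B_def by (rule LeastI)
  have B2: "B \<ge> 2"
  proof (rule ccontr)
    assume "\<not> B \<ge> 2"
    then have "B ^ 3 \<le> 1" by (cases "B = 0") (auto simp: not_le less_2_cases_iff)
    then show False using B assms by simp
  qed
  then have "\<not> m \<le> (B - 1) ^ 3"
    using not_less_Least[of "B - 1" "\<lambda>B. m \<le> B ^ 3"] by (simp add: B_def)
  moreover have "B ^ 3 \<le> (2 * (B - 1)) ^ 3" using B2 by (intro power_mono) auto
  then have "B ^ 3 \<le> 8 * (B - 1) ^ 3" by (simp only: power_mult_distrib) simp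
  ultimately have "B ^ 3 < 8 * m" by linarith
  then show thesis using that B B2 by blast
qed

text \<open>At a point with power pair \<open>(\<alpha>, \<beta>)\<close> the high powers
  \<open>x^(n b)\<close> and \<open>(x - 1)^(n c)\<close> become the constants
  \<open>\<alpha>^b\<close> and \<open>\<beta>^c\<close>. Each derivative, with its denominator
  cleared, is then the value at \<open>x\<close> of a polynomial of degree below \<open>N\<close>
  that depends on the pair but not on \<open>x\<close>. Making its coefficients vanish handles all
  points over that pair at once.\<close>

lemma auxiliary_poly_root_mod:
  fixes p :: int and l :: "nat \<times> nat \<times> nat \<Rightarrow> int"
  assumes p: "prime p" and "int D \<le> p" and x: "x \<in> power_pair_points p n K"
    and N: "\<And>a k. a < A \<Longrightarrow> k < D \<Longrightarrow> a + k < N"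
    and l: "\<And>\<alpha> \<beta> k i. (\<alpha>, \<beta>) \<in> K \<Longrightarrow> k < D \<Longrightarrow> i < N \<Longrightarrow>
      p dvd (\<Sum>(a, b, c)\<in>{..<A} \<times> {..<B} \<times> {..<B}.
        l (a, b, c) * (\<alpha> ^ b * \<beta> ^ c * coeff (deriv_factor (n * b) (n * c) k (monom 1 a)) i))"
  shows "root_mod p x D (\<Sum>c<B. [:-1, 1:] ^ (n * c) * (\<Sum>b<B. \<Sum>a<A. monom (l (a, b, c)) (a + n * b)))"
    (is "root_mod p x D ?F")
proof (rule root_mod_if_higher_pderiv[OF p \<open>int D \<le> p\<close>])
  fix k assume k: "k < D"
  define I where "I = {..<A} \<times> {..<B} \<times> {..<B}"
  define df where "df a b c = deriv_factor (n * b) (n * c) k (monom 1 a)" for a b c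
  let ?X = "[:0, 1:] :: int poly" and ?Y = "[:-1, 1:] :: int poly"
  define t where "t a b c = monom 1 a * (?X ^ (n * b) * ?Y ^ (n * c))" for a b c
  have mon: "monom (l (a, b, c)) (a + n * b) = Polynomial.smult (l (a, b, c)) (monom 1 a * ?X ^ (n * b))" for a b c
    by (simp add: monom_altdef power_add)
  have "?F = (\<Sum>c<B. \<Sum>b<B. \<Sum>a<A. Polynomial.smult (l (a, b, c)) (t a b c))"
    unfolding mon sum_distrib_left t_def by (simp add: mult_ac)
  also have "\<dots> = (\<Sum>b<B. \<Sum>c<B. \<Sum>a<A. Polynomial.smult (l (a, b, c)) (t a b c))" by (rule sum.swap)
  also have "\<dots> = (\<Sum>b<B. \<Sum>a<A. \<Sum>c<B. Polynomial.smult (l (a, b, c)) (t a b c))"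
    by (intro sum.cong refl sum.swap)
  also have "\<dots> = (\<Sum>a<A. \<Sum>b<B. \<Sum>c<B. Polynomial.smult (l (a, b, c)) (t a b c))" by (rule sum.swap)
  also have "\<dots> = (\<Sum>(a, b, c)\<in>I. Polynomial.smult (l (a, b, c)) (t a b c))"
    unfolding I_def by (simp add: sum.cartesian_product)
  finally have "?F = (\<Sum>(a, b, c)\<in>I. Polynomial.smult (l (a, b, c)) (t a b c))" .
  then have "(pderiv ^^ k) ?F = (\<Sum>(a, b, c)\<in>I. Polynomial.smult (l (a, b, c)) ((pderiv ^^ k) (t a b c)))"
    by (simp add: higher_pderiv_sum higher_pderiv_smult case_prod_unfold)
  then have "(pderiv ^^ k) ?F * (?X ^ k * ?Y ^ k)
      = (\<Sum>(a, b, c)\<in>I. Polynomial.smult (l (a, b, c)) ((pderiv ^^ k) (t a b c) * (?X ^ k * ?Y ^ k)))"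
    by (simp add: sum_distrib_right case_prod_unfold)
  also have "\<dots> = (\<Sum>(a, b, c)\<in>I. Polynomial.smult (l (a, b, c)) (?X ^ (n * b) * ?Y ^ (n * c) * df a b c))"
    unfolding t_def df_def higher_pderiv_deriv_factor ..
  finally have "poly ((pderiv ^^ k) ?F * (?X ^ k * ?Y ^ k)) x
      = poly (\<Sum>(a, b, c)\<in>I. Polynomial.smult (l (a, b, c)) (?X ^ (n * b) * ?Y ^ (n * c) * df a b c)) x"
    by (rule arg_cong)
  then have eval: "poly ((pderiv ^^ k) ?F) x * (x ^ k * (x - 1) ^ k)
      = (\<Sum>(a, b, c)\<in>I. l (a, b, c) * (x ^ (n * b) * (x - 1) ^ (n * c) * poly (df a b c) x))"
    by (simp add: poly_sum case_prod_unfold)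
  define \<alpha> \<beta> where "\<alpha> = x ^ n mod p" and "\<beta> = (x - 1) ^ n mod p"
  have K: "(\<alpha>, \<beta>) \<in> K" and xp: "x \<in> {2..<p}"
    using x by (auto simp: power_pair_points_def \<alpha>_def \<beta>_def)
  have "[x ^ n = \<alpha>] (mod p)" "[(x - 1) ^ n = \<beta>] (mod p)" by (simp_all add: \<alpha>_def \<beta>_def)
  then have "[(\<Sum>(a, b, c)\<in>I. l (a, b, c) * (x ^ (n * b) * (x - 1) ^ (n * c) * poly (df a b c) x))
      = (\<Sum>(a, b, c)\<in>I. l (a, b, c) * (\<alpha> ^ b * \<beta> ^ c * poly (df a b c) x))] (mod p)"
    unfolding case_prod_unfold power_mult by (intro cong_sum cong_mult cong_refl cong_pow)
  moreover have "p dvd (\<Sum>(a, b, c)\<in>I. l (a, b, c) * (\<alpha> ^ b * \<beta> ^ c * poly (df a b c) x))"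
  proof -
    have "poly (df a b c) x = (\<Sum>i<N. coeff (df a b c) i * x ^ i)" if "a < A" for a b c
      using degree_deriv_factor[of "n * b" "n * c" k "monom 1 a"] N[OF that k]
      by (intro poly_eq_sum_coeff) (simp add: df_def degree_monom_eq)
    then have "(\<Sum>(a, b, c)\<in>I. l (a, b, c) * (\<alpha> ^ b * \<beta> ^ c * poly (df a b c) x))
        = (\<Sum>(a, b, c)\<in>I. \<Sum>i<N. x ^ i * (l (a, b, c) * (\<alpha> ^ b * \<beta> ^ c * coeff (df a b c) i)))"
      by (intro sum.cong refl) (auto simp: I_def sum_distrib_left mult_ac)
    also have "\<dots> = (\<Sum>i<N. x ^ i * (\<Sum>(a, b, c)\<in>I. l (a, b, c) * (\<alpha> ^ b * \<beta> ^ c * coeff (df a b c) i)))"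
      unfolding case_prod_unfold by (subst sum.swap) (simp add: sum_distrib_left)
    also have "p dvd \<dots>"
    proof (intro dvd_sum[OF dvd_mult])
      fix i assume "i \<in> {..<N}"
      then show "p dvd (\<Sum>(a, b, c)\<in>I. l (a, b, c) * (\<alpha> ^ b * \<beta> ^ c * coeff (df a b c) i))"
        using l[OF K k, of i] by (simp add: I_def df_def)
    qed
    finally show ?thesis .
  qed
  ultimately have "p dvd poly ((pderiv ^^ k) ?F) x * (x ^ k * (x - 1) ^ k)"
    unfolding eval using cong_dvd_iff by blast
  moreover have "\<not> p dvd x" "\<not> p dvd x - 1"
    using xp zdvd_imp_le[of p x] zdvd_imp_le[of p "x - 1"] by auto
  ultimately show "p dvd poly ((pderiv ^^ k) ?F) x"
    using p by (auto simp: prime_dvd_mult_iff dest: prime_dvd_power)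
qed

text \<open>There are \<open>A * B^2\<close> unknown coefficients, and vanishing to order
  \<open>A\<close> costs \<open>2 * A\<close> conditions for each of \<open>A\<close> derivatives
  and each of \<open>T\<close> pairs. Comparing the degree, at most \<open>2 * n * B\<close>, with
  the order \<open>A\<close> bounds the number of points by \<open>2 * n * B / A\<close>, which is
  about \<open>B^2\<close> when \<open>A * B\<close> is close to \<open>n\<close>. So
  \<open>B\<close> is taken as small as \<open>2 * T * A < B^2\<close> permits, of the order of the
  cube root of \<open>T * n\<close>.\<close>

theorem card_power_pair_points:
  fixes p :: int
  assumes p: "prime p" and K: "finite K" "K \<noteq> {}"
    and small: "32 * card K \<le> n ^ 2" "32 * int (card K) * int n ^ 4 \<le> p ^ 3"
  shows "card (power_pair_points p n K) ^ 3 \<le> 65536 * (n * card K) ^ 2"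
proof -
  define T where "T = card K"
  have T: "T \<ge> 1" using K by (simp add: T_def Suc_le_eq card_gt_0_iff)
  have "32 \<le> n ^ 2" using small(1) T by (simp add: T_def)
  then have n: "n \<ge> 1" by (cases n) auto
  have Tn: "1 \<le> T * n" using T n by (metis mult_le_mono nat_mult_1)
  then have "4 * (T * n) > 1" by linarith
  \<comment> \<open>The lower bound on \<open>B^3\<close> gives the surplus of unknowns. The upper
    bound turns the two smallness hypotheses into \<open>B <= n\<close>, hence
    \<open>A >= 1\<close>, and \<open>n * B <= p\<close>, hence exponents below
    \<open>p\<close>.\<close>
  then obtain B where B2: "B \<ge> 2" and Bl: "4 * (T * n) \<le> B ^ 3" and Bu: "B ^ 3 < 8 * (4 * (T * n))"
    using cube_root_parameter by blast
  have p0: "p > 0" using p prime_gt_0_int by blast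
  have "B ^ 3 \<le> 32 * T * n" using Bu by simp
  also have "\<dots> \<le> n ^ 2 * n" using small(1) by (simp add: T_def)
  finally have "B ^ 3 \<le> n ^ 3" by (simp add: power3_eq_cube power2_eq_square)
  then have Bn: "B \<le> n" using power_le_imp_le_base[of B 2 n] by (simp add: numeral_eq_Suc)
  have "int (n * B) ^ 3 = int (B ^ 3) * int n ^ 3" by (simp add: power_mult_distrib)
  also have "\<dots> \<le> int (32 * T * n) * int n ^ 3"
    by (rule mult_right_mono) (use Bu in linarith, simp)
  also have "\<dots> = 32 * int T * int n ^ 4" by (simp add: power_numeral_reduce)
  also have "\<dots> \<le> p ^ 3" using small(2) by (simp add: T_def)
  finally have nB: "int (n * B) \<le> p"
    using power_le_imp_le_base[of "int (n * B)" 2 p] p0 by (simp add: numeral_eq_Suc)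
  define A where "A = n div B"
  have AB: "A * B \<le> n" by (simp add: A_def)
  have A1: "1 \<le> A" using Bn B2 by (simp add: A_def div_greater_zero_iff Suc_le_eq)
  have An: "A \<le> n" by (simp add: A_def)
  have "n < A * B + B" unfolding A_def using B2 dividend_less_div_times[of B n] by simp
  \<comment> \<open>Rounding in \<open>n div B\<close> loses at most a factor 2, because the
    quotient is at least 1.\<close>
  then have AB2: "n \<le> 2 * (A * B)" using A1 by (metis add_le_mono le_trans less_imp_le mult_2 mult_le_mono1 nat_mult_1 order_refl)
  have "2 * T * A * B \<le> 2 * T * n" using AB by simp
  also have "\<dots> < B ^ 3" using Bl Tn by linarith
  finally have "2 * T * A < B * B" by (simp add: power3_eq_cube)
  then have less: "T * (A * (2 * A)) < A * (B * B)" using A1 by (simp add: mult_ac)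
  let ?I = "{..<A} \<times> {..<B} \<times> {..<B}" and ?J = "K \<times> {..<A} \<times> {..<2 * A}"
  have p1: "p > 1" using p prime_gt_1_int by blast
  have cardJI: "card ?J < card ?I" using less unfolding card_cartesian_product T_def card_lessThan .
  have finIJ: "finite ?I" "finite ?J" using K by simp_all
  define M where "M j i = (case j of ((\<alpha>, \<beta>), k, s) \<Rightarrow> case i of (a, b, c) \<Rightarrow>
      \<alpha> ^ b * \<beta> ^ c * coeff (deriv_factor (n * b) (n * c) k (monom 1 a)) s)"
    for j :: "(int \<times> int) \<times> nat \<times> nat" and i :: "nat \<times> nat \<times> nat"
  obtain l where l: "\<And>j. j \<in> ?J \<Longrightarrow> p dvd (\<Sum>i\<in>?I. l i * M j i)" "\<exists>i\<in>?I. \<not> p dvd l i"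
    using homogeneous_system_mod[OF p1 finIJ cardJI, of M] by blast
  define F where "F = (\<Sum>c<B. [:-1, 1:] ^ (n * c) * (\<Sum>b<B. \<Sum>a<A. monom (l (a, b, c)) (a + n * b)))"
  have F0: "\<not> [:p:] dvd F"
    using auxiliary_poly_nonzero_mod[OF p AB nB, of _ _ _ "\<lambda>a b c. l (a, b, c)"] l(2)
    unfolding F_def by auto
  have "root_mod p x A F" if "x \<in> power_pair_points p n K" for x
    unfolding F_def
  proof (rule auxiliary_poly_root_mod[OF p _ that, where N = "2 * A"])
    have "A \<le> n * B" using An B2 by (metis le_trans mult_le_mono2 nat_mult_1_right one_le_numeral)
    then show "int A \<le> p" using nB by linarith
  next
    fix \<alpha> \<beta> k s assume "(\<alpha>, \<beta>) \<in> K" "k < A" "s < 2 * A"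
    then show "p dvd (\<Sum>(a, b, c)\<in>?I.
        l (a, b, c) * (\<alpha> ^ b * \<beta> ^ c * coeff (deriv_factor (n * b) (n * c) k (monom 1 a)) s))"
      using l(1)[of "((\<alpha>, \<beta>), k, s)"] by (simp add: M_def case_prod_unfold)
  qed simp
  then have "A * card (power_pair_points p n K) \<le> degree F"
    by (intro multiplicity_count_mod[OF p _ F0]) (auto simp: power_pair_points_def)
  also have "degree F \<le> 2 * (n * B)"
    unfolding F_def
  proof (intro degree_sum_le order.trans[OF degree_mult_le], simp)
    fix c assume c: "c \<in> {..<B}"
    have "degree (\<Sum>b<B. \<Sum>a<A. monom (l (a, b, c)) (a + n * b)) \<le> n * B"
    proof (intro degree_sum_le order.trans[OF degree_monom_le]; simp)
      fix a b assume "a < A" "b < B"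
      then have "a + n * b \<le> n + n * b" using An by simp
      also have "\<dots> \<le> n * B" using \<open>b < B\<close> by (metis Suc_leI mult_Suc_right mult_le_mono2)
      finally show "a + n * b \<le> n * B" .
    qed
    moreover have "degree ([:-1, 1:] ^ (n * c) :: int poly) \<le> n * B"
      using c by (simp add: degree_linear_power)
    ultimately show "degree ([:-1, 1:] ^ (n * c) :: int poly)
        + degree (\<Sum>b<B. \<Sum>a<A. monom (l (a, b, c)) (a + n * b)) \<le> 2 * (n * B)" by simp
  qed
  finally have AX: "A * card (power_pair_points p n K) \<le> 2 * (n * B)" .
  define X where "X = card (power_pair_points p n K)"
  have "n * X \<le> 2 * (A * B) * X" using AB2 by (rule mult_le_mono1)
  also have "\<dots> = 2 * B * (A * X)" by simp
  also have "\<dots> \<le> 2 * B * (2 * (n * B))" using AX by (intro mult_le_mono2) (simp add: X_def)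
  also have "\<dots> = n * (4 * B ^ 2)" by (simp add: power2_eq_square)
  finally have "X \<le> 4 * B ^ 2" using n by simp
  \<comment> \<open>The final constant is \<open>65536 = 64 * 32^2\<close>: the 4 is cubed, and the
    bound \<open>B^3 < 32 * T * n\<close> is squared.\<close>
  then have "X ^ 3 \<le> (4 * B ^ 2) ^ 3" by (rule power_mono) simp
  also have "\<dots> = 64 * (B ^ 3) ^ 2" by (simp add: power_mult_distrib power_mult[symmetric])
  also have "\<dots> \<le> 64 * (32 * (T * n)) ^ 2" using Bu by (intro mult_le_mono2 power_mono) auto
  also have "\<dots> = 65536 * (n * T) ^ 2" by (simp add: power_mult_distrib mult_ac)
  finally show ?thesis by (simp add: X_def T_def)
qed

section \<open>Stepanov's bound in the range \<open>n^6 = O(p^3)\<close>\<close>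

lemma finite_power_pair_points [simp]: "finite (power_pair_points p n K)"
  by (rule finite_subset[of _ "{2..<p}"]) (auto simp: power_pair_points_def)

text \<open>The single condition \<open>M * card K <= n^2\<close> implies both smallness conditions:
  the first through \<open>32 <= M\<close>, the second because
  \<open>32 * M * card K * n^4 <= 32 * n^6 <= M * p^3\<close>.\<close>

lemma card_power_pair_points_le:
  fixes p :: int
  assumes p: "prime p" and M: "32 \<le> M" "32 * int n ^ 6 \<le> int M * p ^ 3"
    and K: "finite K" "M * card K \<le> n ^ 2"
  shows "card (power_pair_points p n K) ^ 3 \<le> 65536 * (n * card K) ^ 2"
proof (cases "K = {}")
  case False
  have "32 * card K \<le> M * card K" using M(1) by (rule mult_le_mono1)
  then have "32 * card K \<le> n ^ 2" using K by linarith
  moreover have "int M * (32 * int (card K) * int n ^ 4) \<le> int M * p ^ 3"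
  proof -
    have "int M * (32 * int (card K) * int n ^ 4) = 32 * int (M * card K) * int n ^ 4" by simp
    also have "\<dots> \<le> 32 * int (n ^ 2) * int n ^ 4"
      using K(2) by (intro mult_right_mono mult_left_mono) (simp_all only: of_nat_le_iff, simp_all)
    also have "\<dots> = 32 * int n ^ 6" by (simp add: power_add[symmetric])
    finally show ?thesis using M(2) by linarith
  qed
  then have "32 * int (card K) * int n ^ 4 \<le> p ^ 3" using M(1) by simp
  ultimately show ?thesis using card_power_pair_points[OF p K(1) False] by blast
qed (simp add: power_pair_points_def)

text \<open>For sets $K$ too large for Stepanov's method the trivial bound $|Y| \le n^2$ is as good.\<close>

lemma card_points_inter_le:
  fixes p :: int
  assumes p: "prime p" and M: "32 \<le> M" "32 * int n ^ 6 \<le> int M * p ^ 3"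
    and K: "finite K" and Y: "finite Y" "card Y \<le> n ^ 2"
  shows "card (power_pair_points p n K \<inter> Y) ^ 3 \<le> 65536 * M ^ 2 * (n * card K) ^ 2"
proof -
  consider "M * card K \<le> n ^ 2" | "n ^ 2 < M * card K"
    by linarith
  then show ?thesis
  proof cases
    case 1
    have "card (power_pair_points p n K \<inter> Y) \<le> card (power_pair_points p n K)"
      by (intro card_mono) auto
    then have "card (power_pair_points p n K \<inter> Y) ^ 3 \<le> card (power_pair_points p n K) ^ 3"
      by (rule power_mono) simp
    moreover have "65536 * 1 * (n * card K) ^ 2 \<le> 65536 * M ^ 2 * (n * card K) ^ 2"
      using M(1) by (intro mult_le_mono1 mult_le_mono2) simp
    ultimately show ?thesis using card_power_pair_points_le[OF p M K 1] by linarith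
  next
    case 2
    have "card (power_pair_points p n K \<inter> Y) \<le> n ^ 2"
      using Y by (meson card_mono inf_le2 le_trans)
    then have "card (power_pair_points p n K \<inter> Y) ^ 3 \<le> (n ^ 2) ^ 3" by (rule power_mono) simp
    also have "\<dots> = n ^ 2 * (n ^ 2) ^ 2" by (simp add: power_add[symmetric] power_mult[symmetric])
    also have "\<dots> \<le> n ^ 2 * (M * card K) ^ 2" using 2 by (intro mult_le_mono2 power_mono) auto
    also have "\<dots> = 1 * (M ^ 2 * (n * card K) ^ 2)" by (simp add: power_mult_distrib mult_ac)
    also have "\<dots> \<le> 65536 * (M ^ 2 * (n * card K) ^ 2)" by (rule mult_le_mono1) simp
    finally show ?thesis by simp
  qed
qed

text \<open>Points over different pairs are disjoint, so Stepanov's bound gives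
  \<open>(\<tau> * card K)^3 = O((n * card K)^2)\<close>, and \<open>(card K)^2\<close> cancels. The
  cases only serve to bring \<open>K\<close> into the admissible range.\<close>

lemma card_popular_pairs_le:
  fixes p :: int
  assumes p: "prime p" and M: "32 \<le> M" "32 * int n ^ 6 \<le> int M * p ^ 3" and n: "n \<ge> 1"
    and K: "finite K" "card K \<le> n ^ 2"
    and \<tau>: "\<tau> \<le> n" "\<And>k. k \<in> K \<Longrightarrow> \<tau> \<le> card (power_pair_points p n {k})"
  shows "\<tau> ^ 3 * card K \<le> 131072 * M ^ 2 * n ^ 2"
proof -
  have sub: "\<tau> ^ 3 * card K' \<le> 65536 * n ^ 2" if K': "K' \<subseteq> K" "M * card K' \<le> n ^ 2" for K'
  proof (cases "K' = {}")
    case False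
    have fin: "finite K'" using K(1) K'(1) finite_subset by blast
    have "card K' * \<tau> = (\<Sum>k\<in>K'. \<tau>)" by simp
    also have "\<dots> \<le> (\<Sum>k\<in>K'. card (power_pair_points p n {k}))"
      using \<tau>(2) K'(1) by (intro sum_mono) auto
    also have "\<dots> = card (\<Union>k\<in>K'. power_pair_points p n {k})"
      using fin by (intro card_UN_disjoint[symmetric]) (auto, auto simp: power_pair_points_def)
    also have "(\<Union>k\<in>K'. power_pair_points p n {k}) = power_pair_points p n K'"
      by (auto simp: power_pair_points_def)
    finally have "(card K' * \<tau>) ^ 3 \<le> 65536 * (n * card K') ^ 2"
      using card_power_pair_points_le[OF p M fin K'(2)] by (meson le_trans power_mono zero_le)
    then have "card K' ^ 2 * (\<tau> ^ 3 * card K') \<le> card K' ^ 2 * (65536 * n ^ 2)"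
      by (simp add: power_mult_distrib mult_ac power3_eq_cube power2_eq_square)
    moreover have "card K' ^ 2 > 0" using False fin by (simp add: card_gt_0_iff)
    ultimately show ?thesis by (simp only: mult_le_cancel1)
  qed simp
  have M2: "65536 * n ^ 2 \<le> 131072 * M ^ 2 * n ^ 2"
  proof (rule mult_le_mono1)
    have "1 \<le> M ^ 2" using M(1) by simp
    then show "65536 \<le> 131072 * M ^ 2" by linarith
  qed
  consider "M * card K \<le> n ^ 2" | "n ^ 2 < M * card K" "M \<le> n ^ 2" | "n ^ 2 < M"
    by linarith
  then show ?thesis
  proof cases
    case 1
    then show ?thesis using sub[OF order.refl 1] M2 by linarith
  next
    case 2
    \<comment> \<open>The largest admissible size of a subset. Since \<open>q >= 1\<close>, rounding
      loses at most a factor 2, so passing from \<open>K\<close> to a subset of size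
      \<open>q\<close> costs \<open>2 * M\<close>; hence \<open>131072 = 2 * 65536\<close>.\<close>
    define q where "q = n ^ 2 div M"
    have Mq: "M * q \<le> n ^ 2" by (simp add: q_def)
    have q1: "1 \<le> q" using 2(2) M(1) by (simp add: q_def div_greater_zero_iff Suc_le_eq)
    have "n ^ 2 < q * M + M" unfolding q_def using M(1) dividend_less_div_times[of M "n ^ 2"] by simp
    moreover have "M \<le> q * M" using mult_le_mono1[OF q1, of M] by (simp only: mult_1)
    ultimately have "n ^ 2 \<le> 2 * (q * M)" by linarith
    then have n2: "n ^ 2 \<le> 2 * M * q" by (simp only: mult_ac)
    have "M * q < M * card K" using Mq 2(1) by linarith
    then have "q \<le> card K" by simp
    then obtain K' where K': "K' \<subseteq> K" "card K' = q" by (rule obtain_subset_with_card_n)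
    have "\<tau> ^ 3 * card K \<le> \<tau> ^ 3 * (2 * M * q)" using K(2) n2 by (intro mult_le_mono2) linarith
    also have "\<dots> = 2 * M * (\<tau> ^ 3 * card K')" by (simp add: K'(2))
    also have "\<dots> \<le> 2 * M * (65536 * n ^ 2)" using sub[of K'] K' Mq by (intro mult_le_mono2) simp
    also have "\<dots> \<le> 131072 * M ^ 2 * n ^ 2" using M(1) by (simp add: power2_eq_square)
    finally show ?thesis .
  next
    case 3
    \<comment> \<open>No nonempty set is admissible here, but \<open>n^2 < M\<close>, so the trivial
      bounds on \<open>\<tau>\<close> and \<open>card K\<close> suffice.\<close>
    have "\<tau> ^ 3 \<le> n ^ 3" using \<tau>(1) by (rule power_mono) simp
    also have "\<dots> \<le> n ^ 4" using n by (intro power_increasing) auto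
    also have "\<dots> = (n ^ 2) ^ 2" by (simp add: power_mult[symmetric])
    also have "\<dots> \<le> M ^ 2" using 3 by (intro power_mono) auto
    finally have "\<tau> ^ 3 * card K \<le> M ^ 2 * n ^ 2" using K(2) by (rule mult_le_mono)
    then show ?thesis by simp
  qed
qed

section \<open>Summation of weak-type bounds\<close>

text \<open>Since \<open>m^2 <= m * (m + 1)\<close>, a square is at most the sum of
  \<open>2 * k\<close> over \<open>1 <= k <= m\<close>. After exchanging the sums, level
  \<open>k\<close> contributes at most \<open>2 * Q / k\<close>.\<close>

lemma sum_square_le_of_weak_bound:
  fixes f :: "'a \<Rightarrow> nat" and Q :: real
  assumes "finite X" and N: "\<And>x. x \<in> X \<Longrightarrow> f x \<le> N"
    and Q: "\<And>k. 1 \<le> k \<Longrightarrow> k \<le> N \<Longrightarrow> real (card {x \<in> X. k \<le> f x}) * real k ^ 2 \<le> Q"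
  shows "(\<Sum>x\<in>X. real (f x) ^ 2) \<le> 2 * Q * harm N"
proof -
  have sq: "real m ^ 2 \<le> (\<Sum>k=1..m. 2 * real k)" for m
    by (induction m) (simp_all add: power2_eq_square algebra_simps)
  have "real (f x) ^ 2 \<le> (\<Sum>k=1..N. if k \<le> f x then 2 * real k else 0)" if "x \<in> X" for x
  proof -
    have "(\<Sum>k=1..N. if k \<le> f x then 2 * real k else 0) = (\<Sum>k\<in>{k\<in>{1..N}. k \<le> f x}. 2 * real k)"
      by (rule sum.inter_filter[symmetric]) simp
    also have "{k\<in>{1..N}. k \<le> f x} = {1..f x}" using N[OF that] by auto
    finally show ?thesis using sq[of "f x"] by simp
  qed
  then have "(\<Sum>x\<in>X. real (f x) ^ 2) \<le> (\<Sum>x\<in>X. \<Sum>k=1..N. if k \<le> f x then 2 * real k else 0)"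
    by (rule sum_mono)
  also have "\<dots> = (\<Sum>k=1..N. \<Sum>x\<in>X. if k \<le> f x then 2 * real k else 0)" by (rule sum.swap)
  also have "\<dots> = (\<Sum>k=1..N. 2 * (real (card {x \<in> X. k \<le> f x}) * real k))"
    using assms(1) by (simp add: sum.inter_filter[symmetric] mult_ac)
  also have "\<dots> \<le> (\<Sum>k=1..N. 2 * (Q * inverse (real k)))"
  proof (intro sum_mono mult_left_mono)
    fix k assume "k \<in> {1..N}"
    then show "real (card {x \<in> X. k \<le> f x}) * real k \<le> Q * inverse (real k)"
      using Q[of k] by (simp add: field_simps power2_eq_square)
  qed simp
  also have "\<dots> = 2 * Q * harm N" by (simp add: harm_def sum_distrib_left mult_ac)
  finally show ?thesis .
qed

text \<open>On each fibre of \<open>\<pi>\<close> the function \<open>g\<close> is replaced by its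
  maximum \<open>\<rho>\<close>, so the sum is at most that of \<open>F * \<rho>\<close>, with
  \<open>F\<close> the fibre size. A level set of \<open>\<rho>\<close> lies in the image of a level
  set of \<open>g\<close>, which is why \<open>Q1\<close> concerns images: several popular elements
  over one point count once.\<close>

lemma square_sum_le_of_weak_bounds:
  fixes g :: "'a \<Rightarrow> nat" and \<pi> :: "'a \<Rightarrow> 'b" and Q1 Q2 :: real
  assumes fin: "finite G" and gN: "\<And>e. e \<in> G \<Longrightarrow> g e \<le> N"
    and FN: "\<And>x. x \<in> \<pi> ` G \<Longrightarrow> card {e \<in> G. \<pi> e = x} \<le> N"
    and Q1: "\<And>k. 1 \<le> k \<Longrightarrow> k \<le> N \<Longrightarrow> real (card (\<pi> ` {e \<in> G. k \<le> g e})) * real k ^ 2 \<le> Q1"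
    and Q2: "\<And>k. 1 \<le> k \<Longrightarrow> k \<le> N \<Longrightarrow>
      real (card {x \<in> \<pi> ` G. k \<le> card {e \<in> G. \<pi> e = x}}) * real k ^ 2 \<le> Q2"
  shows "real (\<Sum>e\<in>G. g e) ^ 2 \<le> 4 * Q1 * Q2 * harm N ^ 2"
proof -
  define \<rho> where "\<rho> x = Max (g ` {e \<in> G. \<pi> e = x})" for x
  define F where "F x = card {e \<in> G. \<pi> e = x}" for x
  have \<rho>: "g e \<le> \<rho> x" if "e \<in> G" "\<pi> e = x" for e x
    unfolding \<rho>_def using fin that by (intro Max_ge) auto
  have \<rho>_ex: "\<exists>e\<in>G. \<pi> e = x \<and> \<rho> x = g e" if "x \<in> \<pi> ` G" for x
  proof -
    have "\<rho> x \<in> g ` {e \<in> G. \<pi> e = x}" unfolding \<rho>_def using fin that by (intro Max_in) auto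
    then show ?thesis by auto
  qed
  have "(\<Sum>e\<in>G. g e) = (\<Sum>x\<in>\<pi> ` G. \<Sum>e\<in>{e \<in> G. \<pi> e = x}. g e)" by (rule sum.image_gen[OF fin])
  also have "\<dots> \<le> (\<Sum>x\<in>\<pi> ` G. \<Sum>e\<in>{e \<in> G. \<pi> e = x}. \<rho> x)" by (intro sum_mono \<rho>) auto
  also have "\<dots> = (\<Sum>x\<in>\<pi> ` G. F x * \<rho> x)" by (simp add: F_def)
  finally have "real (\<Sum>e\<in>G. g e) \<le> real (\<Sum>x\<in>\<pi> ` G. F x * \<rho> x)" by (simp only: of_nat_le_iff)
  then have "real (\<Sum>e\<in>G. g e) ^ 2 \<le> real (\<Sum>x\<in>\<pi> ` G. F x * \<rho> x) ^ 2"
    using of_nat_0_le_iff by (rule power_mono)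
  also have "\<dots> = (\<Sum>x\<in>\<pi> ` G. real (F x) * real (\<rho> x)) ^ 2" by simp
  also have "\<dots> \<le> (\<Sum>x\<in>\<pi> ` G. real (F x) ^ 2) * (\<Sum>x\<in>\<pi> ` G. real (\<rho> x) ^ 2)"
    by (rule Cauchy_Schwarz_ineq_sum)
  also have "\<dots> \<le> (2 * Q2 * harm N) * (2 * Q1 * harm N)"
  proof (intro mult_mono sum_nonneg)
    show F2: "(\<Sum>x\<in>\<pi> ` G. real (F x) ^ 2) \<le> 2 * Q2 * harm N"
      unfolding F_def using fin FN Q2 by (intro sum_square_le_of_weak_bound) auto
    have "0 \<le> (\<Sum>x\<in>\<pi> ` G. real (F x) ^ 2)" by (intro sum_nonneg) simp
    then show "0 \<le> 2 * Q2 * harm N" using F2 by linarith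
    show "(\<Sum>x\<in>\<pi> ` G. real (\<rho> x) ^ 2) \<le> 2 * Q1 * harm N"
    proof (rule sum_square_le_of_weak_bound)
      show "\<rho> x \<le> N" if "x \<in> \<pi> ` G" for x using \<rho>_ex[OF that] gN by auto
      fix k assume k: "1 \<le> k" "k \<le> N"
      have "{x \<in> \<pi> ` G. k \<le> \<rho> x} \<subseteq> \<pi> ` {e \<in> G. k \<le> g e}"
      proof
        fix x assume x: "x \<in> {x \<in> \<pi> ` G. k \<le> \<rho> x}"
        then obtain e where "e \<in> G" "\<pi> e = x" "\<rho> x = g e" using \<rho>_ex[of x] by blast
        then show "x \<in> \<pi> ` {e \<in> G. k \<le> g e}" using x by auto
      qed
      then have "card {x \<in> \<pi> ` G. k \<le> \<rho> x} \<le> card (\<pi> ` {e \<in> G. k \<le> g e})"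
        using fin by (intro card_mono) auto
      then have "real (card {x \<in> \<pi> ` G. k \<le> \<rho> x}) * real k ^ 2
          \<le> real (card (\<pi> ` {e \<in> G. k \<le> g e})) * real k ^ 2"
        by (intro mult_right_mono) auto
      then show "real (card {x \<in> \<pi> ` G. k \<le> \<rho> x}) * real k ^ 2 \<le> Q1" using Q1[OF k] by linarith
    qed (use fin in simp)
  qed simp
  finally show ?thesis by (simp add: power2_eq_square mult_ac)
qed

lemma harm_le_log2:
  assumes "n \<ge> 2"
  shows "harm n \<le> 2 * log 2 (real n)"
proof -
  obtain m where m: "n = Suc m" using assms by (cases n) auto
  have "harm (Suc m) - ln (real (Suc m)) \<le> harm (Suc 0) - ln (real (Suc 0))"
    by (rule decseqD[OF decseq_harm_diff_ln]) simp
  then have "harm n \<le> 1 + ln (real n)" by (simp add: m harm_expand)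
  moreover have "1 \<le> log 2 (real n)" using assms by (simp add: le_log_iff)
  moreover have "ln (real n) \<le> log 2 (real n)"
  proof -
    have "ln (2::real) \<le> 1" using ln_le_minus_one[of 2] by simp
    moreover have "0 \<le> log 2 (real n)" using \<open>1 \<le> log 2 (real n)\<close> by simp
    ultimately have "log 2 (real n) * ln 2 \<le> log 2 (real n) * 1" by (intro mult_left_mono)
    then show ?thesis by (simp add: log_def)
  qed
  ultimately show ?thesis by linarith
qed

section \<open>Multiplicative subgroups\<close>

definition mod_quot :: "int \<Rightarrow> int \<Rightarrow> int \<Rightarrow> int" where
  "mod_quot p a b = a * modular_inverse p b mod p"

lemma mod_quot_mult:
  assumes "prime p" "\<not> p dvd b"
  shows "[mod_quot p a b * b = a] (mod p)"
proof -
  have "coprime p b" using assms by (rule prime_imp_coprime)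
  then have "[b * modular_inverse p b = 1] (mod p)"
    by (intro cong_modular_inverse1) (simp only: coprime_commute)
  then have "[a * (b * modular_inverse p b) = a * 1] (mod p)" by (rule cong_mult[OF cong_refl])
  moreover have "[mod_quot p a b * b = a * modular_inverse p b * b] (mod p)"
    unfolding mod_quot_def by (intro cong_mult) simp_all
  ultimately show ?thesis by (simp add: mult_ac) (meson cong_trans)
qed

lemma mod_quot_bounds: "p > 0 \<Longrightarrow> mod_quot p a b \<in> {0..<p}"
  by (simp add: mod_quot_def)

lemma cong_mult_rcancel_prime:
  fixes p :: int
  assumes "prime p" "\<not> p dvd k" "[a * k = b * k] (mod p)"
  shows "[a = b] (mod p)"
proof -
  have "coprime p k" using assms(1,2) by (rule prime_imp_coprime)
  then have "coprime k p" by (simp only: coprime_commute)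
  then show ?thesis using assms(3) cong_mult_rcancel by blast
qed

lemma cong_imp_eq:
  fixes a b p :: int
  shows "[a = b] (mod p) \<Longrightarrow> a \<in> {0..<p} \<Longrightarrow> b \<in> {0..<p} \<Longrightarrow> a = b"
  by (auto simp: cong_def)

text \<open>The group is kept as a set of integer representatives. Closure under products and
  finiteness give a subgroup, since multiplication by an element is an injection of \<open>G\<close>
  into itself, hence a permutation.\<close>

locale mod_subgroup =
  fixes p :: int and G :: "int set" and n :: nat
  assumes prime: "prime p" and G_subset: "G \<subseteq> {1..<p}" and card_G: "card G = n"
    and one_in: "1 \<in> G" and mult_in: "\<And>a b. a \<in> G \<Longrightarrow> b \<in> G \<Longrightarrow> a * b mod p \<in> G"
begin

lemma p_pos: "p > 0" using prime prime_gt_0_int by blast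

lemma finite_G: "finite G" using G_subset finite_subset by blast

lemma n_pos: "n \<ge> 1" using one_in finite_G card_G by (metis One_nat_def Suc_leI card_gt_0_iff empty_iff)

lemma G_range: "a \<in> G \<Longrightarrow> a \<in> {0..<p}" using G_subset by auto

lemma G_not_dvd: "a \<in> G \<Longrightarrow> \<not> p dvd a"
  using G_subset zdvd_imp_le[of p a] by auto

text \<open>Multiplication by \<open>a\<close> permutes \<open>G\<close>, so it preserves the
  product of all elements; on the other hand it multiplies this product by
  \<open>a^n\<close>.\<close>

lemma power_G:
  assumes a: "a \<in> G"
  shows "[a ^ n = 1] (mod p)"
proof -
  have inj: "inj_on (\<lambda>g. a * g mod p) G"
  proof (rule inj_onI)
    fix g g' assume *: "g \<in> G" "g' \<in> G" "a * g mod p = a * g' mod p"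
    then have "[g * a = g' * a] (mod p)" by (simp only: cong_def mult.commute)
    then have "[g = g'] (mod p)" by (rule cong_mult_rcancel_prime[OF prime G_not_dvd[OF a]])
    then show "g = g'" using * G_range cong_imp_eq by blast
  qed
  have img: "(\<lambda>g. a * g mod p) ` G = G"
    using mult_in[OF a] by (intro endo_inj_surj[OF finite_G _ inj]) auto
  have "(\<Prod>g\<in>G. g) = (\<Prod>g\<in>G. a * g mod p)"
    using prod.reindex[OF inj, of "\<lambda>g. g"] unfolding img by (simp only: o_def)
  moreover have "[(\<Prod>g\<in>G. a * g mod p) = (\<Prod>g\<in>G. a * g)] (mod p)" by (intro cong_prod) simp
  moreover have "(\<Prod>g\<in>G. a * g) = a ^ n * (\<Prod>g\<in>G. g)" by (simp add: prod.distrib card_G)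
  ultimately have "[(\<Prod>g\<in>G. g) = a ^ n * (\<Prod>g\<in>G. g)] (mod p)" by (simp only:)
  then have "[a ^ n * (\<Prod>g\<in>G. g) = 1 * (\<Prod>g\<in>G. g)] (mod p)" by (simp only: mult_1 cong_sym_eq)
  moreover have "\<not> p dvd (\<Prod>g\<in>G. g)"
    using prime finite_G G_not_dvd by (auto simp: prime_dvd_prod_iff)
  ultimately show ?thesis using cong_mult_rcancel_prime[OF prime] by blast
qed

definition diff_count :: "int \<Rightarrow> nat" where
  "diff_count u = card {(b, d) \<in> G \<times> G. [b - d = u] (mod p)}"

definition sumset :: "int set" where
  "sumset = (\<lambda>(a, b). (a + b) mod p) ` (G \<times> G)"

lemma finite_sumset: "finite sumset" unfolding sumset_def using finite_G by simp

lemma sumset_range: "s \<in> sumset \<Longrightarrow> s \<in> {0..<p}" using p_pos by (auto simp: sumset_def)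

lemma diff_count_le: "diff_count u \<le> n"
proof -
  have "inj_on snd {(b, d) \<in> G \<times> G. [b - d = u] (mod p)}"
  proof (rule inj_onI, clarsimp)
    fix b b' d assume *: "b \<in> G" "b' \<in> G" "[b - d = u] (mod p)" "[b' - d = u] (mod p)"
    then have "[b - d = b' - d] (mod p)" by (meson cong_sym cong_trans)
    then have "[b = b'] (mod p)" by (simp add: cong_iff_dvd_diff)
    then show "b = b'" using * G_range cong_imp_eq by blast
  qed
  then show ?thesis
    unfolding diff_count_def card_G[symmetric] by (rule card_inj_on_le) (use finite_G in auto)
qed

lemma in_pointsI:
  assumes "x \<in> {0..<p}" "\<not> p dvd x" "\<not> p dvd x - 1"
    and "[x ^ n = \<alpha>] (mod p)" "[(x - 1) ^ n = \<beta>] (mod p)"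
  shows "x \<in> power_pair_points p n {(\<alpha> mod p, \<beta> mod p)}"
proof -
  have "x \<noteq> 0" "x \<noteq> 1" using assms(2,3) by auto
  then show ?thesis using assms by (auto simp: power_pair_points_def cong_def)
qed

text \<open>A representation \<open>u = b - d\<close> is sent to \<open>x = b / d\<close>. Then
  \<open>x^n = 1\<close> and \<open>x - 1 = u / d\<close> has the same \<open>n\<close>-th power as
  \<open>u\<close>; conversely \<open>x\<close> determines \<open>d = u / (x - 1)\<close> and then
  \<open>b\<close>.\<close>

lemma diff_count_le_points:
  assumes u: "\<not> p dvd u"
  shows "diff_count u \<le> card (power_pair_points p n {(1 mod p, u ^ n mod p)})"
  unfolding diff_count_def
proof (rule card_inj_on_le)
  let ?f = "\<lambda>(b, d). mod_quot p b d"
  show "inj_on ?f {(b, d) \<in> G \<times> G. [b - d = u] (mod p)}"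
  proof (rule inj_onI, clarsimp)
    fix b d b' d'
    assume *: "b \<in> G" "d \<in> G" "[b - d = u] (mod p)" "b' \<in> G" "d' \<in> G" "[b' - d' = u] (mod p)"
      "mod_quot p b d = mod_quot p b' d'"
    define x where "x = mod_quot p b d"
    have x: "[x * d = b] (mod p)" "[x * d' = b'] (mod p)"
      using mod_quot_mult[OF prime G_not_dvd[OF *(2)], of b]
        mod_quot_mult[OF prime G_not_dvd[OF *(5)], of b'] *(7) by (simp_all add: x_def)
    have "[d * (x - 1) = b - d] (mod p)" "[d' * (x - 1) = b' - d'] (mod p)"
      using cong_diff[OF x(1) cong_refl[of d]] cong_diff[OF x(2) cong_refl[of d']]
      by (simp_all add: algebra_simps)
    then have du: "[d * (x - 1) = u] (mod p)" "[d' * (x - 1) = u] (mod p)"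
      using *(3,6) by (blast intro: cong_trans)+
    then have 1: "[d * (x - 1) = d' * (x - 1)] (mod p)" by (blast intro: cong_trans cong_sym)
    have "\<not> p dvd d * (x - 1)" using u cong_dvd_iff[OF du(1)] by simp
    then have "\<not> p dvd x - 1" by auto
    then have "[d = d'] (mod p)" using cong_mult_rcancel_prime[OF prime _ 1] by blast
    then have d: "d = d'" using * G_range cong_imp_eq by blast
    then have "[b = b'] (mod p)" using x by (meson cong_sym cong_trans)
    then show "b = b' \<and> d = d'" using * G_range cong_imp_eq d by blast
  qed
  show "?f ` {(b, d) \<in> G \<times> G. [b - d = u] (mod p)} \<subseteq> power_pair_points p n {(1 mod p, u ^ n mod p)}"
  proof clarify
    fix b d assume *: "b \<in> G" "d \<in> G" "[b - d = u] (mod p)"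
    define x where "x = mod_quot p b d"
    have x: "[x * d = b] (mod p)" using mod_quot_mult[OF prime G_not_dvd] * by (auto simp: x_def)
    have x1: "[(x - 1) * d = u] (mod p)"
    proof -
      have "[(x - 1) * d = b - d] (mod p)"
        using cong_diff[OF x cong_refl[of d]] by (simp add: algebra_simps)
      then show ?thesis using *(3) by (rule cong_trans)
    qed
    have "x \<in> power_pair_points p n {(1 mod p, u ^ n mod p)}"
    proof (rule in_pointsI)
      show "x \<in> {0..<p}" unfolding x_def by (rule mod_quot_bounds[OF p_pos])
      show "\<not> p dvd x" using x G_not_dvd[OF *(1)] by (meson cong_dvd_iff dvd_mult2)
      show "\<not> p dvd x - 1" using x1 u by (meson cong_dvd_iff dvd_mult2)
      have pw: "[z ^ n = y ^ n] (mod p)" if "[z * d = y] (mod p)" for y z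
      proof -
        have "[z ^ n * d ^ n = y ^ n] (mod p)" using cong_pow[OF that] by (simp add: power_mult_distrib)
        moreover have "[z ^ n * d ^ n = z ^ n * 1] (mod p)" using power_G[OF *(2)] by (intro cong_mult) auto
        ultimately show ?thesis by (metis cong_sym cong_trans mult.right_neutral)
      qed
      show "[x ^ n = 1] (mod p)" using pw[OF x] power_G[OF *(1)] by (rule cong_trans)
      show "[(x - 1) ^ n = u ^ n] (mod p)" by (rule pw[OF x1])
    qed
    then show "mod_quot p b d \<in> power_pair_points p n {(1 mod p, u ^ n mod p)}" by (simp add: x_def)
  qed
qed simp

text \<open>If $x (1 + c) = 1 + a$, then $w = (x - 1) / a$ satisfies $w - 1 = - x c / a$, and
  $a, c$ do not contribute to $n$-th powers.\<close>

lemma quotient_count_le_points: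
  assumes x: "\<not> p dvd x" "\<not> p dvd x - 1"
  shows "card {(a, c) \<in> G \<times> G. [x * (1 + c) = 1 + a] (mod p)}
    \<le> card (power_pair_points p n {((x - 1) ^ n mod p, (-1) ^ n * x ^ n mod p)})"
proof (rule card_inj_on_le)
  let ?f = "\<lambda>(a, c). mod_quot p (x - 1) a"
  show "inj_on ?f {(a, c) \<in> G \<times> G. [x * (1 + c) = 1 + a] (mod p)}"
  proof (rule inj_onI, clarsimp)
    fix a c a' c'
    assume *: "a \<in> G" "c \<in> G" "[x * (1 + c) = 1 + a] (mod p)" "a' \<in> G" "c' \<in> G"
      "[x * (1 + c') = 1 + a'] (mod p)" "mod_quot p (x - 1) a = mod_quot p (x - 1) a'"
    define w where "w = mod_quot p (x - 1) a"
    have w: "[w * a = x - 1] (mod p)" "[w * a' = x - 1] (mod p)"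
      using mod_quot_mult[OF prime G_not_dvd[OF *(1)], of "x - 1"]
        mod_quot_mult[OF prime G_not_dvd[OF *(4)], of "x - 1"] *(7) by (simp_all add: w_def)
    \<comment> \<open>As \<open>w\<close> is invertible, \<open>w * a = x - 1\<close> determines
      \<open>a\<close>, and then the equation for \<open>x\<close> determines
      \<open>c\<close>.\<close>
    have "\<not> p dvd w" using w(1) x(2) by (meson cong_dvd_iff dvd_mult2)
    moreover have "[a * w = a' * w] (mod p)" using w by (metis cong_sym cong_trans mult.commute)
    ultimately have "[a = a'] (mod p)" using cong_mult_rcancel_prime[OF prime] by blast
    then have a: "a = a'" using * G_range cong_imp_eq by blast
    then have "[x * (1 + c) = x * (1 + c')] (mod p)" using * by (meson cong_sym cong_trans)
    then have "[(1 + c) * x = (1 + c') * x] (mod p)" by (simp add: mult.commute)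
    then have "[1 + c = 1 + c'] (mod p)" using x(1) cong_mult_rcancel_prime[OF prime] by blast
    then have "[c = c'] (mod p)" by (simp add: cong_iff_dvd_diff)
    then show "a = a' \<and> c = c'" using * G_range cong_imp_eq a by blast
  qed
  show "?f ` {(a, c) \<in> G \<times> G. [x * (1 + c) = 1 + a] (mod p)}
      \<subseteq> power_pair_points p n {((x - 1) ^ n mod p, (-1) ^ n * x ^ n mod p)}"
  proof clarify
    fix a c assume *: "a \<in> G" "c \<in> G" "[x * (1 + c) = 1 + a] (mod p)"
    define w where "w = mod_quot p (x - 1) a"
    have w: "[w * a = x - 1] (mod p)"
      using mod_quot_mult[OF prime G_not_dvd] * by (auto simp: w_def)
    have "[(w - 1) * a = x - 1 - a] (mod p)"
      using cong_diff[OF w cong_refl[of a]] by (simp add: algebra_simps)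
    moreover have "[x - 1 - a = - x * c] (mod p)"
    proof -
      have "x - 1 - a - (- x * c) = x * (1 + c) - (1 + a)" by (simp add: algebra_simps)
      then show ?thesis using *(3) by (simp only: cong_iff_dvd_diff)
    qed
    ultimately have w1: "[(w - 1) * a = - x * c] (mod p)" by (rule cong_trans)
    have Gp: "[z ^ n * g ^ n = z ^ n] (mod p)" if "g \<in> G" for z g
      using cong_mult[OF cong_refl power_G[OF that], of "z ^ n"] by simp
    have "w \<in> power_pair_points p n {((x - 1) ^ n mod p, (-1) ^ n * x ^ n mod p)}"
    proof (rule in_pointsI)
      show "w \<in> {0..<p}" unfolding w_def by (rule mod_quot_bounds[OF p_pos])
      show "\<not> p dvd w" using w x(2) by (meson cong_dvd_iff dvd_mult2)
      have "\<not> p dvd - x * c" using x(1) G_not_dvd[OF *(2)] prime by (simp add: prime_dvd_mult_iff)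
      then show "\<not> p dvd w - 1" using w1 by (meson cong_dvd_iff dvd_mult2)
      show "[w ^ n = (x - 1) ^ n] (mod p)"
        using cong_pow[OF w, of n] Gp[OF *(1), of w]
        by (simp only: power_mult_distrib) (meson cong_sym cong_trans)
      have "[(w - 1) ^ n * a ^ n = (- x) ^ n * c ^ n] (mod p)"
        using cong_pow[OF w1, of n] by (simp only: power_mult_distrib)
      then have "[(w - 1) ^ n = (- x) ^ n] (mod p)"
        using Gp[OF *(1), of "w - 1"] Gp[OF *(2), of "- x"] by (meson cong_sym cong_trans)
      then show "[(w - 1) ^ n = (-1) ^ n * x ^ n] (mod p)"
        by (simp only: power_minus[of x])
    qed
    then show "mod_quot p (x - 1) a \<in> power_pair_points p n {((x - 1) ^ n mod p, (-1) ^ n * x ^ n mod p)}"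
      by (simp add: w_def)
  qed
qed simp

text \<open>The nonzero part of the sumset is invariant under multiplication by \<open>G\<close>,
  and such a multiplication preserves \<open>n\<close>-th powers. Hence every value is taken on a
  whole coset, that is, at least \<open>n\<close> times.\<close>

lemma card_powers_sumset: "n * card ((\<lambda>s. s ^ n mod p) ` (sumset - {0})) \<le> card sumset"
proof -
  let ?h = "\<lambda>s. s ^ n mod p" and ?S = "sumset - {0}"
  have "n \<le> card {s \<in> ?S. ?h s = \<sigma>}" if "\<sigma> \<in> ?h ` ?S" for \<sigma>
  proof -
    from that obtain s where s: "s \<in> ?S" "\<sigma> = ?h s" by auto
    then obtain a b where ab: "a \<in> G" "b \<in> G" "s = (a + b) mod p" by (auto simp: sumset_def)
    have ps: "\<not> p dvd s"
      using s sumset_range[of s] zdvd_imp_le[of p s] by (auto simp: le_less)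
    have "inj_on (\<lambda>g. g * s mod p) G"
    proof (rule inj_onI)
      fix g g' assume *: "g \<in> G" "g' \<in> G" "g * s mod p = g' * s mod p"
      then have "[g * s = g' * s] (mod p)" by (simp only: cong_def)
      then have "[g = g'] (mod p)" by (rule cong_mult_rcancel_prime[OF prime ps])
      then show "g = g'" using * G_range cong_imp_eq by blast
    qed
    moreover have "(\<lambda>g. g * s mod p) ` G \<subseteq> {s \<in> ?S. ?h s = \<sigma>}"
    proof (rule image_subsetI)
      fix g assume g: "g \<in> G"
      have "g * s mod p = ((g * a mod p) + (g * b mod p)) mod p"
        unfolding ab(3) by (simp add: mod_simps distrib_left)
      then have "g * s mod p \<in> sumset" using mult_in[OF g ab(1)] mult_in[OF g ab(2)] by (auto simp: sumset_def)
      moreover have "\<not> p dvd g * s" using ps G_not_dvd[OF g] prime by (simp add: prime_dvd_mult_iff)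
      moreover have "(g * s mod p) ^ n mod p = \<sigma>"
      proof -
        have "[g ^ n * s ^ n = 1 * s ^ n] (mod p)" using power_G[OF g] by (intro cong_mult) auto
        then show ?thesis unfolding s(2) by (simp add: power_mod power_mult_distrib cong_def)
      qed
      ultimately show "g * s mod p \<in> {s \<in> ?S. ?h s = \<sigma>}" by (simp add: dvd_eq_mod_eq_0)
    qed
    ultimately show ?thesis
      using card_inj_on_le[of "\<lambda>g. g * s mod p" G] finite_sumset card_G by auto
  qed
  then have "(\<Sum>\<sigma>\<in>?h ` ?S. n) \<le> (\<Sum>\<sigma>\<in>?h ` ?S. card {s \<in> ?S. ?h s = \<sigma>})" by (rule sum_mono)
  also have "\<dots> = card ?S" using sum.image_gen[of ?S "\<lambda>_. 1::nat" ?h] finite_sumset by simp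
  also have "\<dots> \<le> card sumset" using finite_sumset by (intro card_mono) auto
  finally show ?thesis by (simp add: mult.commute)
qed

text \<open>Cauchy--Schwarz is applied to the numbers \<open>m s\<close> of representations as a
  sum. Their second moment counts the solutions of \<open>a + d = b + c\<close>, which are regrouped
  as \<open>b - d = a - c\<close>.\<close>

lemma energy_ge:
  "real n ^ 4 \<le> real (card sumset) * real (\<Sum>(a, c)\<in>G \<times> G. diff_count (a - c))"
proof -
  define m where "m s = card {e \<in> G \<times> G. (\<lambda>(a, b). (a + b) mod p) e = s}" for s
  let ?f = "\<lambda>(a, b). (a + b) mod p"
  have "real n ^ 2 = real (card (G \<times> G))" by (simp add: card_cartesian_product card_G power2_eq_square)
  also have "card (G \<times> G) = (\<Sum>s\<in>sumset. m s)"
    unfolding m_def sumset_def using sum.image_gen[of "G \<times> G" "\<lambda>_. 1::nat" ?f] finite_G by simp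
  finally have "real n ^ 4 = (\<Sum>s\<in>sumset. 1 * real (m s)) ^ 2" by (simp add: power2_eq_square power4_eq_xxxx)
  also have "\<dots> \<le> (\<Sum>s\<in>sumset. 1 ^ 2) * (\<Sum>s\<in>sumset. real (m s) ^ 2)"
    by (rule Cauchy_Schwarz_ineq_sum)
  also have "\<dots> = real (card sumset) * real (\<Sum>s\<in>sumset. m s * m s)" by (simp add: power2_eq_square)
  also have "(\<Sum>s\<in>sumset. m s * m s) = (\<Sum>s\<in>sumset. \<Sum>e\<in>{e \<in> G \<times> G. ?f e = s}. m (?f e))"
    by (simp add: m_def)
  also have "\<dots> = (\<Sum>e\<in>G \<times> G. m (?f e))"
    unfolding sumset_def using finite_G by (intro sum.image_gen[symmetric]) simp
  also have "\<dots> = (\<Sum>a\<in>G. \<Sum>d\<in>G. \<Sum>b\<in>G. \<Sum>c\<in>G. of_bool ([b - d = a - c] (mod p)))"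
  proof -
    have "m ((a + d) mod p) = (\<Sum>b\<in>G. \<Sum>c\<in>G. of_bool ([b - d = a - c] (mod p)))" for a d
    proof -
      have "(b + c) mod p = (a + d) mod p \<longleftrightarrow> [b - d = a - c] (mod p)" for b c
        by (simp add: mod_eq_dvd_iff cong_iff_dvd_diff algebra_simps)
      then have "m ((a + d) mod p) = card {e \<in> G \<times> G. [fst e - d = a - snd e] (mod p)}"
        by (simp add: m_def case_prod_unfold)
      also have "\<dots> = (\<Sum>e\<in>G \<times> G. of_bool ([fst e - d = a - snd e] (mod p)))"
        using finite_G by (simp add: Int_def)
      finally show ?thesis by (simp add: sum.cartesian_product case_prod_unfold)
    qed
    then show ?thesis by (simp add: sum.cartesian_product')
  qed
  also have "\<dots> = (\<Sum>a\<in>G. \<Sum>c\<in>G. \<Sum>b\<in>G. \<Sum>d\<in>G. of_bool ([b - d = a - c] (mod p)))"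
  proof (rule sum.cong[OF refl])
    fix a
    have "(\<Sum>d\<in>G. \<Sum>b\<in>G. \<Sum>c\<in>G. of_bool ([b - d = a - c] (mod p)))
        = (\<Sum>b\<in>G. \<Sum>d\<in>G. \<Sum>c\<in>G. of_bool ([b - d = a - c] (mod p)) :: nat)" by (rule sum.swap)
    also have "\<dots> = (\<Sum>b\<in>G. \<Sum>c\<in>G. \<Sum>d\<in>G. of_bool ([b - d = a - c] (mod p)))"
      by (intro sum.cong refl sum.swap)
    also have "\<dots> = (\<Sum>c\<in>G. \<Sum>b\<in>G. \<Sum>d\<in>G. of_bool ([b - d = a - c] (mod p)))" by (rule sum.swap)
    finally show "(\<Sum>d\<in>G. \<Sum>b\<in>G. \<Sum>c\<in>G. of_bool ([b - d = a - c] (mod p)))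
        = (\<Sum>c\<in>G. \<Sum>b\<in>G. \<Sum>d\<in>G. of_bool ([b - d = a - c] (mod p)) :: nat)" .
  qed
  also have "\<dots> = (\<Sum>(a, c)\<in>G \<times> G. diff_count (a - c))"
  proof -
    have "diff_count u = (\<Sum>b\<in>G. \<Sum>d\<in>G. of_bool ([b - d = u] (mod p)))" for u
    proof -
      have "diff_count u = card {e \<in> G \<times> G. [fst e - snd e = u] (mod p)}"
        unfolding diff_count_def by (rule arg_cong[where f = card]) auto
      also have "\<dots> = (\<Sum>e\<in>G \<times> G. of_bool ([fst e - snd e = u] (mod p)))"
        using finite_G by (simp add: Int_def)
      finally show ?thesis by (simp add: sum.cartesian_product case_prod_unfold)
    qed
    then show ?thesis by (simp add: sum.cartesian_product')
  qed
  finally show ?thesis .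
qed

end

text \<open>Eliminates the number \<open>V\<close> of popular values between Stepanov's bound for
  \<open>t * V\<close> pairs and the popularity bound for \<open>V\<close>. It is used with
  \<open>t = 1\<close> for the fibres of the ratio and with \<open>t = (card H)^2\<close> for the
  differences.\<close>

lemma weak_bound_from_cubes:
  fixes X k n c d :: nat
  assumes X: "X ^ 3 \<le> c * (n * (t * V)) ^ 2" and V: "k ^ 3 * V \<le> d * n ^ 2"
  shows "(X * k ^ 2) ^ 3 \<le> c * d ^ 2 * (n ^ 6 * t ^ 2)"
proof -
  have "(X * k ^ 2) ^ 3 = X ^ 3 * (k ^ 3) ^ 2" by (simp add: power_mult_distrib power_mult[symmetric])
  also have "\<dots> \<le> c * (n * (t * V)) ^ 2 * (k ^ 3) ^ 2" using X by (rule mult_le_mono1)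
  also have "\<dots> = c * (n * t) ^ 2 * (k ^ 3 * V) ^ 2" by (simp add: power_mult_distrib mult_ac)
  also have "\<dots> \<le> c * (n * t) ^ 2 * (d * n ^ 2) ^ 2"
    using V by (intro mult_le_mono2 power_mono) auto
  also have "\<dots> = c * d ^ 2 * (n ^ 6 * t ^ 2)"
    by (simp add: numeral_eq_Suc mult_ac)
  finally show ?thesis .
qed

section \<open>The energy bound through the ratios \<open>(1 + a) / (1 + c)\<close>\<close>

context mod_subgroup
begin

text \<open>The conditions make the ratio well defined and different from 0 and 1 modulo
  \<open>p\<close>.\<close>

definition good_pairs :: "(int \<times> int) set" where
  "good_pairs = {(a, c) \<in> G \<times> G. a \<noteq> c \<and> \<not> p dvd 1 + a \<and> \<not> p dvd 1 + c}"

definition ratio :: "int \<times> int \<Rightarrow> int" where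
  "ratio = (\<lambda>(a, c). mod_quot p (1 + a) (1 + c))"

lemma finite_good_pairs: "finite good_pairs"
  by (rule finite_subset[of _ "G \<times> G"]) (auto simp: good_pairs_def finite_G)

lemma card_good_pairs: "card good_pairs \<le> n ^ 2"
proof -
  have "card good_pairs \<le> card (G \<times> G)"
    using finite_G by (intro card_mono) (auto simp: good_pairs_def)
  then show ?thesis by (simp add: card_cartesian_product card_G power2_eq_square)
qed

lemma card_ratio: "card (ratio ` good_pairs) \<le> n ^ 2"
  using card_image_le[OF finite_good_pairs, of ratio] card_good_pairs by linarith

lemma not_dvd_diff: "a \<in> G \<Longrightarrow> c \<in> G \<Longrightarrow> a \<noteq> c \<Longrightarrow> \<not> p dvd a - c"
  using G_range cong_imp_eq[of a c p] by (auto simp: cong_iff_dvd_diff)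

lemma ratio_props:
  assumes "(a, c) \<in> good_pairs"
  defines "x \<equiv> ratio (a, c)"
  shows "[x * (1 + c) = 1 + a] (mod p)" "[(x - 1) * (1 + c) = a - c] (mod p)"
    "x \<in> {0..<p}" "\<not> p dvd x" "\<not> p dvd x - 1"
proof -
  have ac: "a \<in> G" "c \<in> G" "a \<noteq> c" "\<not> p dvd 1 + a" "\<not> p dvd 1 + c"
    using assms(1) by (auto simp: good_pairs_def)
  show 1: "[x * (1 + c) = 1 + a] (mod p)"
    unfolding x_def ratio_def using mod_quot_mult[OF prime ac(5)] by simp
  show 2: "[(x - 1) * (1 + c) = a - c] (mod p)"
    using cong_diff[OF 1 cong_refl[of "1 + c"]] by (simp add: algebra_simps)
  show "x \<in> {0..<p}" unfolding x_def ratio_def using mod_quot_bounds[OF p_pos] by simp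
  have "\<not> p dvd x * (1 + c)" using cong_dvd_iff[OF 1] ac by blast
  then show "\<not> p dvd x" by auto
  have "\<not> p dvd (x - 1) * (1 + c)" using cong_dvd_iff[OF 2] not_dvd_diff ac by blast
  then show "\<not> p dvd x - 1" by auto
qed

text \<open>The excluded pairs lie on the diagonal or have a coordinate \<open>p - 1\<close>, so
  there are at most \<open>3 * n\<close> of them, each contributing at most
  \<open>n\<close>.\<close>

lemma energy_le_good:
  "(\<Sum>(a, c)\<in>G \<times> G. diff_count (a - c)) \<le> (\<Sum>(a, c)\<in>good_pairs. diff_count (a - c)) + 3 * n ^ 2"
proof -
  define bad where "bad = (\<lambda>a. (a, a)) ` G \<union> {p - 1} \<times> G \<union> G \<times> {p - 1}"
  have p1: "a = p - 1" if "a \<in> G" "p dvd 1 + a" for a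
  proof -
    have "p \<le> 1 + a" using that G_subset by (intro zdvd_imp_le) auto
    then show ?thesis using G_range[OF that(1)] by auto
  qed
  have "G \<times> G - good_pairs \<subseteq> bad" using p1 by (auto simp: good_pairs_def bad_def)
  moreover have "finite bad" using finite_G by (simp add: bad_def)
  ultimately have "card (G \<times> G - good_pairs) \<le> card bad" by (rule card_mono[rotated])
  also have "\<dots> \<le> card ((\<lambda>a. (a, a)) ` G) + card ({p - 1} \<times> G) + card (G \<times> {p - 1})"
    unfolding bad_def by (meson card_Un_le add_le_mono le_trans order_refl)
  also have "\<dots> \<le> 3 * n"
    using card_image_le[OF finite_G, of "\<lambda>a. (a, a)"] by (simp add: card_cartesian_product card_G)
  finally have bad: "card (G \<times> G - good_pairs) \<le> 3 * n" .
  have "(\<Sum>(a, c)\<in>G \<times> G. diff_count (a - c)) = (\<Sum>(a, c)\<in>good_pairs. diff_count (a - c))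
      + (\<Sum>(a, c)\<in>G \<times> G - good_pairs. diff_count (a - c))"
  proof -
    have "good_pairs \<subseteq> G \<times> G" "finite (G \<times> G)" using finite_G by (auto simp: good_pairs_def)
    then show ?thesis by (subst add.commute) (rule sum.subset_diff)
  qed
  also have "(\<Sum>(a, c)\<in>G \<times> G - good_pairs. diff_count (a - c)) \<le> (\<Sum>e\<in>G \<times> G - good_pairs. n)"
    using diff_count_le by (intro sum_mono) auto
  also have "\<dots> \<le> 3 * n ^ 2" using mult_le_mono1[OF bad, of n] by (simp add: power2_eq_square)
  finally show ?thesis by simp
qed

lemma ratio_fiber_le_count:
  "card {e \<in> good_pairs. ratio e = x} \<le> card {(a, c) \<in> G \<times> G. [x * (1 + c) = 1 + a] (mod p)}"
proof (rule card_mono)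
  show "finite {(a, c) \<in> G \<times> G. [x * (1 + c) = 1 + a] (mod p)}"
    by (rule finite_subset[of _ "G \<times> G"]) (auto simp: finite_G)
  show "{e \<in> good_pairs. ratio e = x} \<subseteq> {(a, c) \<in> G \<times> G. [x * (1 + c) = 1 + a] (mod p)}"
    using ratio_props(1) by (auto simp: good_pairs_def)
qed

lemma ratio_fiber_le: "card {e \<in> good_pairs. ratio e = x} \<le> n"
proof -
  have "inj_on snd {e \<in> good_pairs. ratio e = x}"
  proof (rule inj_onI, clarsimp)
    fix a a' c assume *: "(a, c) \<in> good_pairs" "(a', c) \<in> good_pairs"
      "x = ratio (a, c)" "ratio (a', c) = ratio (a, c)"
    then have "[1 + a = 1 + a'] (mod p)"
      using ratio_props(1)[OF *(1)] ratio_props(1)[OF *(2)] by (metis cong_sym cong_trans)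
    then have "[a = a'] (mod p)" by (simp add: cong_iff_dvd_diff)
    then show "a = a'" using * G_range cong_imp_eq by (auto simp: good_pairs_def)
  qed
  then show ?thesis
    unfolding card_G[symmetric] by (rule card_inj_on_le) (use finite_G in \<open>auto simp: good_pairs_def\<close>)
qed

context
  fixes M :: nat
  assumes M: "32 \<le> M" "32 * int n ^ 6 \<le> int M * p ^ 3"
begin

text \<open>Stepanov's method is used twice. A large fibre over \<open>x\<close> makes the pair
  \<open>\<phi> x\<close> popular, so few pairs \<open>\<phi> x\<close> occur; since
  \<open>x\<close> itself is a point over \<open>\<psi> x\<close>, a second application bounds the
  number of such \<open>x\<close>.\<close>

lemma ratio_fiber_weak_bound:
  assumes k: "1 \<le> k" "k \<le> n"
  shows "(card {x \<in> ratio ` good_pairs. k \<le> card {e \<in> good_pairs. ratio e = x}} * k ^ 2) ^ 3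
    \<le> 65536 * M ^ 2 * (131072 * M ^ 2) ^ 2 * n ^ 6"
proof -
  define Z where "Z = {x \<in> ratio ` good_pairs. k \<le> card {e \<in> good_pairs. ratio e = x}}"
  define \<phi> where "\<phi> x = ((x - 1) ^ n mod p, (-1) ^ n * x ^ n mod p)" for x
  define \<psi> where "\<psi> x = (x ^ n mod p, (x - 1) ^ n mod p)" for x
  have finZ: "finite Z" using finite_good_pairs by (simp add: Z_def)
  have props: "x \<in> {0..<p}" "\<not> p dvd x" "\<not> p dvd x - 1" if "x \<in> Z" for x
    using that ratio_props(3-5) by (auto simp: Z_def)
  have "card Z \<le> card (ratio ` good_pairs)"
    using finite_good_pairs by (intro card_mono) (auto simp: Z_def)
  then have "card Z \<le> n ^ 2" using card_ratio by linarith
  then have card_\<phi>: "card (\<phi> ` Z) \<le> n ^ 2" using card_image_le[OF finZ, of \<phi>] by linarith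
  have V: "k ^ 3 * card (\<phi> ` Z) \<le> 131072 * M ^ 2 * n ^ 2"
  proof (rule card_popular_pairs_le[OF prime M n_pos _ card_\<phi> k(2)])
    fix e assume "e \<in> \<phi> ` Z"
    then obtain x where x: "x \<in> Z" "e = \<phi> x" by blast
    have "k \<le> card {e \<in> good_pairs. ratio e = x}" using x(1) by (simp add: Z_def)
    also note ratio_fiber_le_count
    also note quotient_count_le_points[OF props(2,3)[OF x(1)]]
    finally show "k \<le> card (power_pair_points p n {e})" by (simp add: x(2) \<phi>_def)
  qed (use finZ in simp)
  \<comment> \<open>The two pairs agree up to order and the sign \<open>(-1)^n\<close>, which is its
    own inverse, so there are no more pairs \<open>\<psi> x\<close> than pairs
    \<open>\<phi> x\<close>.\<close>
  have "\<psi> ` Z = (\<lambda>(A, B). ((-1) ^ n * B mod p, A)) ` \<phi> ` Z"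
  proof -
    have "(-1) ^ n * ((-1) ^ n * x ^ n mod p) mod p = x ^ n mod p" for x :: int
    proof -
      have "(-1) ^ n * ((-1) ^ n * x ^ n mod p) mod p = (-1) ^ n * ((-1) ^ n * x ^ n) mod p"
        by (rule mod_mult_right_eq)
      also have "(-1) ^ n * ((-1) ^ n * x ^ n) = x ^ n"
        by (simp add: mult.assoc[symmetric] power_mult_distrib[symmetric])
      finally show ?thesis .
    qed
    then show ?thesis by (simp add: \<psi>_def \<phi>_def image_image)
  qed
  then have card_\<psi>: "card (\<psi> ` Z) \<le> card (\<phi> ` Z)" using finZ by (simp add: card_image_le)
  have "Z \<subseteq> power_pair_points p n (\<psi> ` Z) \<inter> ratio ` good_pairs"
  proof
    fix x assume x: "x \<in> Z"
    have "x \<noteq> 0" "x \<noteq> 1" using props[OF x] by auto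
    then have "x \<in> {2..<p}" using props(1)[OF x] by auto
    then show "x \<in> power_pair_points p n (\<psi> ` Z) \<inter> ratio ` good_pairs"
      using x by (auto simp: power_pair_points_def \<psi>_def Z_def)
  qed
  then have "card Z \<le> card (power_pair_points p n (\<psi> ` Z) \<inter> ratio ` good_pairs)"
    by (intro card_mono) auto
  then have "card Z ^ 3 \<le> card (power_pair_points p n (\<psi> ` Z) \<inter> ratio ` good_pairs) ^ 3"
    by (rule power_mono) simp
  also have "\<dots> \<le> 65536 * M ^ 2 * (n * card (\<psi> ` Z)) ^ 2"
    using finZ finite_good_pairs by (intro card_points_inter_le[OF prime M _ _ card_ratio]) auto
  also have "\<dots> \<le> 65536 * M ^ 2 * (n * (1 * card (\<phi> ` Z))) ^ 2"
    using card_\<psi> by (intro mult_le_mono2 power_mono) auto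
  finally have "(card Z * k ^ 2) ^ 3 \<le> 65536 * M ^ 2 * (131072 * M ^ 2) ^ 2 * (n ^ 6 * 1 ^ 2)"
    using V by (rule weak_bound_from_cubes)
  then show ?thesis unfolding Z_def by (simp only: power_one mult_1_right)
qed

text \<open>The set \<open>K\<close> collects the candidates for the pair of \<open>x^n\<close> and
  \<open>(x - 1)^n\<close>. Both quotients have the same denominator \<open>(1 + c)^n\<close>, which
  keeps \<open>card K\<close> at \<open>(card H)^2 * card V\<close>.\<close>

lemma diff_count_weak_bound:
  assumes k: "1 \<le> k" "k \<le> n"
  shows "(card (ratio ` {e \<in> good_pairs. k \<le> (\<lambda>(a, c). diff_count (a - c)) e}) * k ^ 2) ^ 3
    \<le> 65536 * M ^ 2 * (131072 * M ^ 2) ^ 2 * (n ^ 2 * card sumset ^ 4)"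
proof -
  define Z where "Z = {e \<in> good_pairs. k \<le> (\<lambda>(a, c). diff_count (a - c)) e}"
  define H where "H = (\<lambda>s. s ^ n mod p) ` (sumset - {0})"
  define V where "V = (\<lambda>(a, c). (a - c) ^ n mod p) ` Z"
  define K where "K = (\<lambda>((s, s'), v). (mod_quot p s s', mod_quot p v s')) ` ((H \<times> H) \<times> V)"
  have finZ: "finite Z" using finite_good_pairs by (simp add: Z_def)
  have finH: "finite H" using finite_sumset by (simp add: H_def)
  have finV: "finite V" using finZ by (simp add: V_def)
  have "card V \<le> card Z" unfolding V_def by (rule card_image_le[OF finZ])
  also have "\<dots> \<le> card good_pairs" using finite_good_pairs by (intro card_mono) (auto simp: Z_def)
  finally have card_V: "card V \<le> n ^ 2" using card_good_pairs by linarith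
  have "k ^ 3 * card ((\<lambda>v. (1 mod p, v)) ` V) \<le> 131072 * M ^ 2 * n ^ 2"
  proof (rule card_popular_pairs_le[OF prime M n_pos _ _ k(2)])
    show "card ((\<lambda>v. (1 mod p, v)) ` V) \<le> n ^ 2"
      using card_V card_image_le[OF finV, of "\<lambda>v. (1 mod p, v)"] by linarith
    fix e assume "e \<in> (\<lambda>v. (1 mod p, v)) ` V"
    then obtain a c where ac: "(a, c) \<in> good_pairs" "k \<le> diff_count (a - c)"
        "e = (1 mod p, (a - c) ^ n mod p)"
      by (auto simp: V_def Z_def)
    then have "\<not> p dvd a - c" using not_dvd_diff by (auto simp: good_pairs_def)
    then show "k \<le> card (power_pair_points p n {e})"
      using diff_count_le_points[of "a - c"] ac(2,3) by simp
  qed (use finV in simp)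
  then have V: "k ^ 3 * card V \<le> 131072 * M ^ 2 * n ^ 2"
    by (simp add: card_image inj_on_def)
  have "card K \<le> card ((H \<times> H) \<times> V)" unfolding K_def using finH finV by (intro card_image_le) simp
  then have card_K: "card K \<le> card H ^ 2 * card V"
    by (simp add: card_cartesian_product power2_eq_square)
  have "ratio ` Z \<subseteq> power_pair_points p n K \<inter> ratio ` good_pairs"
  proof (rule image_subsetI)
    fix e assume e: "e \<in> Z"
    obtain a c where ac: "e = (a, c)" by (cases e)
    have good: "(a, c) \<in> good_pairs" using e ac by (simp add: Z_def)
    define x where "x = ratio (a, c)"
    note x = ratio_props[OF good, folded x_def]
    have "x \<noteq> 0" "x \<noteq> 1" using x by auto
    then have x2: "x \<in> {2..<p}" using x(3) by auto
    have inH: "(1 + g) ^ n mod p \<in> H" if "g \<in> G" "\<not> p dvd 1 + g" for g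
    proof -
      have "(1 + g) mod p \<in> sumset - {0}"
        using that one_in by (auto simp: sumset_def dvd_eq_mod_eq_0)
      moreover have "(1 + g) ^ n mod p = ((1 + g) mod p) ^ n mod p" by (simp add: power_mod)
      ultimately show ?thesis unfolding H_def by blast
    qed
    have c: "\<not> p dvd (1 + c) ^ n mod p"
      using good prime by (auto simp: good_pairs_def dvd_mod_iff dest: prime_dvd_power)
    have quot: "y ^ n mod p = mod_quot p (z ^ n mod p) ((1 + c) ^ n mod p)"
      if "[y * (1 + c) = z] (mod p)" for y z
    proof (rule cong_imp_eq)
      have "[(y ^ n mod p) * ((1 + c) ^ n mod p) = z ^ n mod p] (mod p)"
        using cong_pow[OF that, of n] by (simp add: cong_def power_mult_distrib mod_simps)
      moreover have "[mod_quot p (z ^ n mod p) ((1 + c) ^ n mod p) * ((1 + c) ^ n mod p) = z ^ n mod p] (mod p)"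
        by (rule mod_quot_mult[OF prime c])
      ultimately have "[(y ^ n mod p) * ((1 + c) ^ n mod p)
          = mod_quot p (z ^ n mod p) ((1 + c) ^ n mod p) * ((1 + c) ^ n mod p)] (mod p)"
        by (blast intro: cong_trans cong_sym)
      then show "[y ^ n mod p = mod_quot p (z ^ n mod p) ((1 + c) ^ n mod p)] (mod p)"
        by (rule cong_mult_rcancel_prime[OF prime c])
      show "y ^ n mod p \<in> {0..<p}" using p_pos by simp
    qed (rule mod_quot_bounds[OF p_pos])
    have "(a - c) ^ n mod p \<in> V" using e ac by (force simp: V_def)
    moreover have "(1 + a) ^ n mod p \<in> H" "(1 + c) ^ n mod p \<in> H"
      using inH good by (auto simp: good_pairs_def)
    ultimately have "(x ^ n mod p, (x - 1) ^ n mod p) \<in> K"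
      unfolding K_def quot[OF x(1)] quot[OF x(2)] by force
    then show "ratio e \<in> power_pair_points p n K \<inter> ratio ` good_pairs"
      using x2 good by (simp add: ac x_def power_pair_points_def)
  qed
  then have "card (ratio ` Z) \<le> card (power_pair_points p n K \<inter> ratio ` good_pairs)"
    by (intro card_mono) auto
  then have "card (ratio ` Z) ^ 3 \<le> card (power_pair_points p n K \<inter> ratio ` good_pairs) ^ 3"
    by (rule power_mono) simp
  also have "\<dots> \<le> 65536 * M ^ 2 * (n * card K) ^ 2"
    using finH finV finite_good_pairs
    by (intro card_points_inter_le[OF prime M _ _ card_ratio]) (auto simp: K_def)
  also have "\<dots> \<le> 65536 * M ^ 2 * (n * (card H ^ 2 * card V)) ^ 2"
    using card_K by (intro mult_le_mono2 power_mono) auto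
  finally have "(card (ratio ` Z) * k ^ 2) ^ 3
      \<le> 65536 * M ^ 2 * (131072 * M ^ 2) ^ 2 * (n ^ 6 * (card H ^ 2) ^ 2)"
    using V by (rule weak_bound_from_cubes)
  \<comment> \<open>Four of the six factors \<open>n\<close> are spent on
    \<open>n * card H <= card sumset\<close>.\<close>
  moreover have "n ^ 6 * (card H ^ 2) ^ 2 = n ^ 2 * (n * card H) ^ 4"
    by (simp add: power_mult_distrib power_mult[symmetric] power_add[symmetric] mult_ac)
  moreover have "(n * card H) ^ 4 \<le> card sumset ^ 4"
    using card_powers_sumset unfolding H_def[symmetric] by (rule power_mono) simp
  then have "65536 * M ^ 2 * (131072 * M ^ 2) ^ 2 * (n ^ 2 * (n * card H) ^ 4)
      \<le> 65536 * M ^ 2 * (131072 * M ^ 2) ^ 2 * (n ^ 2 * card sumset ^ 4)"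
    by (rule mult_le_mono2[OF mult_le_mono2])
  ultimately show ?thesis unfolding Z_def by (simp only:)
qed

end

text \<open>The weak bounds are available for cubes, with a common constant \<open>W\<close>, so
  \<open>Q1\<close> and \<open>Q2\<close> are cube roots. Cubing the bound for \<open>E^2\<close>
  removes the roots and leaves a perfect square on the right.\<close>

lemma energy_upper_bound:
  fixes M :: nat
  assumes M: "32 \<le> M" "32 * int n ^ 6 \<le> int M * p ^ 3"
  defines "W \<equiv> 65536 * M ^ 2 * (131072 * M ^ 2) ^ 2"
  shows "real (\<Sum>(a, c)\<in>good_pairs. diff_count (a - c)) ^ 3
    \<le> 8 * real W * real n ^ 4 * real (card sumset) ^ 2 * harm n ^ 3"
proof -
  define E where "E = (\<Sum>(a, c)\<in>good_pairs. diff_count (a - c))"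
  define Q1 where "Q1 = root 3 (real (W * (n ^ 2 * card sumset ^ 4)))"
  define Q2 where "Q2 = root 3 (real (W * n ^ 6))"
  have root: "real x * real k ^ 2 \<le> root 3 (real y)" if "(x * k ^ 2) ^ 3 \<le> y" for x k y :: nat
  proof -
    have "real (x * k ^ 2) = root 3 (real (x * k ^ 2) ^ 3)" by (simp add: real_root_power_cancel del: of_nat_power of_nat_mult)
    also have "\<dots> \<le> root 3 (real y)" using that by (simp only: of_nat_power[symmetric] of_nat_le_iff real_root_le_iff)
    finally show ?thesis by simp
  qed
  have "real E ^ 2 \<le> 4 * Q1 * Q2 * harm n ^ 2"
    unfolding E_def
  proof (rule square_sum_le_of_weak_bounds[OF finite_good_pairs, where \<pi> = ratio])
    show "(case e of (a, c) \<Rightarrow> diff_count (a - c)) \<le> n" for e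
      using diff_count_le by (cases e) simp
    show "card {e \<in> good_pairs. ratio e = x} \<le> n" for x by (rule ratio_fiber_le)
    fix k assume k: "1 \<le> k" "k \<le> n"
    show "real (card (ratio ` {e \<in> good_pairs. k \<le> (case e of (a, c) \<Rightarrow> diff_count (a - c))})) * real k ^ 2 \<le> Q1"
      unfolding Q1_def W_def by (intro root diff_count_weak_bound[OF M k])
    show "real (card {x \<in> ratio ` good_pairs. k \<le> card {e \<in> good_pairs. ratio e = x}}) * real k ^ 2 \<le> Q2"
      unfolding Q2_def W_def by (intro root ratio_fiber_weak_bound[OF M k])
  qed
  then have "(real E ^ 2) ^ 3 \<le> (4 * Q1 * Q2 * harm n ^ 2) ^ 3" by (rule power_mono) simp
  also have "\<dots> = 64 * Q1 ^ 3 * Q2 ^ 3 * (harm n ^ 3) ^ 2"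
    by (simp add: power_mult_distrib power_mult[symmetric])
  also have "Q1 ^ 3 = real (W * (n ^ 2 * card sumset ^ 4))" unfolding Q1_def by (simp del: of_nat_mult of_nat_power)
  also have "Q2 ^ 3 = real (W * n ^ 6)" unfolding Q2_def by (simp del: of_nat_mult of_nat_power)
  also have "64 * real (W * (n ^ 2 * card sumset ^ 4)) * real (W * n ^ 6) * (harm n ^ 3) ^ 2
      = (8 * real W * real n ^ 4 * real (card sumset) ^ 2 * harm n ^ 3) ^ 2"
    by (simp add: power_mult_distrib power_mult[symmetric] power_add[symmetric] mult_ac) (simp add: power2_eq_square)
  finally have "(real E ^ 3) ^ 2 \<le> (8 * real W * real n ^ 4 * real (card sumset) ^ 2 * harm n ^ 3) ^ 2"
    by (simp add: power_mult[symmetric] mult.commute)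
  then have "real E ^ 3 \<le> 8 * real W * real n ^ 4 * real (card sumset) ^ 2 * harm n ^ 3"
    by (rule power2_le_imp_le) (simp add: harm_nonneg)
  then show ?thesis by (simp add: E_def)
qed

lemma card_sumset_lower_bound:
  fixes M :: nat
  assumes M: "32 \<le> M" "32 * int n ^ 6 \<le> int M * p ^ 3" and n2: "n \<ge> 2"
  defines "W \<equiv> 65536 * M ^ 2 * (131072 * M ^ 2) ^ 2"
  shows "real n ^ 8 \<le> 512 * real W * real (card sumset) ^ 5 * log 2 (real n) ^ 3"
proof -
  define E where "E = (\<Sum>(a, c)\<in>good_pairs. diff_count (a - c))"
  define s where "s = real (card sumset)"
  define L where "L = log 2 (real n)"
  have s0: "s \<ge> 0" by (simp add: s_def)
  have N: "real n \<ge> 2" using n2 by simp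
  have L1: "L \<ge> 1" using n2 by (simp add: L_def le_log_iff)
  have "65536 * 1 * 1 \<le> W"
    unfolding W_def using M(1) by (intro mult_le_mono) auto
  then have W1: "real W \<ge> 65536" by simp
  have "real (\<Sum>(a, c)\<in>G \<times> G. diff_count (a - c)) \<le> real (E + 3 * n ^ 2)"
    using energy_le_good unfolding E_def by (simp only: of_nat_le_iff)
  then have "real (\<Sum>(a, c)\<in>G \<times> G. diff_count (a - c)) \<le> real E + 3 * real n ^ 2"
    by (simp only: of_nat_add of_nat_mult of_nat_power of_nat_numeral)
  then have "s * real (\<Sum>(a, c)\<in>G \<times> G. diff_count (a - c)) \<le> s * (real E + 3 * real n ^ 2)"
    using s0 by (rule mult_left_mono)
  then have ge: "real n ^ 4 \<le> s * (real E + 3 * real n ^ 2)"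
    using energy_ge by (simp add: s_def)
  show ?thesis
  proof (cases "real E \<le> 3 * real n ^ 2")
    case True
    \<comment> \<open>The good pairs do not dominate here, so the energy is of order at most
      \<open>n^2\<close> and the sumset has order at least \<open>n^2\<close>, more than required;
      \<open>7776 = 6^5\<close>.\<close>
    have "real n ^ 2 * real n ^ 2 \<le> s * (real E + 3 * real n ^ 2)" using ge by (simp add: power_add[symmetric])
    also have "\<dots> \<le> s * (6 * real n ^ 2)" using True s0 by (intro mult_left_mono) auto
    finally have "real n ^ 2 * real n ^ 2 \<le> (6 * s) * real n ^ 2" by (simp add: mult_ac)
    then have "real n ^ 2 \<le> 6 * s" by (rule mult_right_le_imp_le) (use N in simp)
    then have "(real n ^ 2) ^ 5 \<le> (6 * s) ^ 5" by (rule power_mono) simp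
    then have "real n ^ 10 \<le> 7776 * s ^ 5" by (simp add: power_mult[symmetric] power_mult_distrib)
    moreover have "real n ^ 8 \<le> real n ^ 10" using N by (intro power_increasing) auto
    moreover have "7776 * s ^ 5 * 1 \<le> 512 * real W * s ^ 5 * L ^ 3"
      using W1 L1 s0 by (intro mult_mono) (auto intro: one_le_power)
    ultimately show ?thesis by (simp add: s_def L_def)
  next
    case False
    \<comment> \<open>Cubing this and inserting the energy bound gives
      \<open>512 = 8 * 8 * 8\<close>: from the cube of 2, from the energy bound, and from the cube
      of 2 in the estimate of \<open>harm n\<close>.\<close>
    have "real n ^ 4 \<le> s * (2 * real E)"
      using ge False s0 by (elim order.trans, intro mult_left_mono) auto
    then have "(real n ^ 4) ^ 3 \<le> (s * (2 * real E)) ^ 3" by (rule power_mono) simp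
    also have "\<dots> = 8 * s ^ 3 * real E ^ 3" by (simp add: power_mult_distrib)
    also have "\<dots> \<le> 8 * s ^ 3 * (8 * real W * real n ^ 4 * s ^ 2 * harm n ^ 3)"
      using energy_upper_bound[OF M] s0 by (intro mult_left_mono) (auto simp: E_def W_def s_def)
    also have "\<dots> \<le> 8 * s ^ 3 * (8 * real W * real n ^ 4 * s ^ 2 * (2 * L) ^ 3)"
      using harm_le_log2[OF n2] s0 by (intro mult_left_mono power_mono) (auto simp: harm_nonneg L_def)
    also have "\<dots> = (512 * real W * s ^ 5 * L ^ 3) * real n ^ 4"
      by (simp add: power_mult_distrib power_add[symmetric] mult_ac)
    also have "(real n ^ 4) ^ 3 = real n ^ 8 * real n ^ 4"
      by (simp add: power_mult[symmetric] power_add[symmetric])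
    finally have "real n ^ 8 \<le> 512 * real W * s ^ 5 * L ^ 3"
      by (rule mult_right_le_imp_le) (use N in simp)
    then show ?thesis by (simp add: s_def L_def)
  qed
qed

end

section \<open>Return to the residue ring and to real exponents\<close>

lemma mod_subgroup_if_subgroup:
  assumes p: "prime p" and sub: "subgroup \<Gamma> (mult_of (residue_ring (int p)))"
  shows "mod_subgroup (int p) \<Gamma> (card \<Gamma>)"
proof
  show "prime (int p)" using p by simp
  show "\<Gamma> \<subseteq> {1..<int p}"
    using subgroup.subset[OF sub] by (auto simp: residue_ring_def)
  show "1 \<in> \<Gamma>" using subgroup.one_closed[OF sub] by (simp add: residue_ring_def)
  show "a * b mod int p \<in> \<Gamma>" if "a \<in> \<Gamma>" "b \<in> \<Gamma>" for a b
    using subgroup.m_closed[OF sub that] by (simp add: residue_ring_def)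
qed simp

theorem corollary31:
  shows "\<forall>C::real. C > 0 \<longrightarrow> (\<exists>c::real. c > 0 \<and>
    (\<forall>p::nat. prime p \<longrightarrow>
      (\<forall>\<Gamma>::int set. subgroup \<Gamma> (mult_of (residue_ring (int p))) \<longrightarrow>
        2 \<le> card \<Gamma> \<longrightarrow> real (card \<Gamma>) \<le> C * sqrt (real p) \<longrightarrow>
        real (card (\<Gamma> <+>\<^bsub>residue_ring (int p)\<^esub> \<Gamma>))
          \<ge> c * (real (card \<Gamma>) powr (8/5) / (log 2 (real (card \<Gamma>))) powr (3/5)))))"
proof (intro allI impI)
  fix C :: real assume C: "C > 0"
  \<comment> \<open>The hypothesis on the order gives \<open>n^6 <= C^6 * p^3\<close>, so any
    \<open>M >= 32 * C^6\<close> is admissible; the summand 32 secures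
    \<open>32 <= M\<close>.\<close>
  define M where "M = nat \<lceil>32 * C ^ 6\<rceil> + 32"
  define Z where "Z = 512 * real (65536 * M ^ 2 * (131072 * M ^ 2) ^ 2)"
  have M32: "32 \<le> M" by (simp add: M_def)
  then have Z: "Z > 0" by (simp add: Z_def)
  show "\<exists>c::real. c > 0 \<and> (\<forall>p::nat. prime p \<longrightarrow>
      (\<forall>\<Gamma>::int set. subgroup \<Gamma> (mult_of (residue_ring (int p))) \<longrightarrow>
        2 \<le> card \<Gamma> \<longrightarrow> real (card \<Gamma>) \<le> C * sqrt (real p) \<longrightarrow>
        real (card (\<Gamma> <+>\<^bsub>residue_ring (int p)\<^esub> \<Gamma>))
          \<ge> c * (real (card \<Gamma>) powr (8/5) / (log 2 (real (card \<Gamma>))) powr (3/5))))"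
  \<comment> \<open>The constant comes from taking the fifth root of
    \<open>n^8 <= Z * s^5 * L^3\<close>.\<close>
  proof (intro exI[of _ "Z powr (- 1/5)"] conjI allI impI)
    show "Z powr (- 1/5) > 0" using Z by simp
    fix p :: nat and \<Gamma> :: "int set"
    assume p: "prime p" and sub: "subgroup \<Gamma> (mult_of (residue_ring (int p)))"
      and n2: "2 \<le> card \<Gamma>" and nC: "real (card \<Gamma>) \<le> C * sqrt (real p)"
    define n where "n = card \<Gamma>"
    define L where "L = log 2 (real n)"
    interpret mod_subgroup "int p" \<Gamma> n
      unfolding n_def using p sub by (rule mod_subgroup_if_subgroup)
    have sumset_eq: "\<Gamma> <+>\<^bsub>residue_ring (int p)\<^esub> \<Gamma> = sumset"
      unfolding set_add_def' sumset_def by (auto simp: residue_ring_def)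
    define s where "s = real (card sumset)"
    have "real n ^ 6 \<le> (C * sqrt (real p)) ^ 6" using nC by (intro power_mono) (auto simp: n_def)
    also have "\<dots> = C ^ 6 * (sqrt (real p) ^ 2) ^ 3" by (simp only: power_mult_distrib power_mult[symmetric]) simp
    finally have "32 * real n ^ 6 \<le> (32 * C ^ 6) * real p ^ 3" by simp
    also have "\<dots> \<le> real M * real p ^ 3"
      by (intro mult_right_mono) (simp_all add: M_def, linarith)
    finally have "real_of_int (32 * int n ^ 6) \<le> real_of_int (int M * int p ^ 3)" by simp
    then have "32 * int n ^ 6 \<le> int M * int p ^ 3" by (simp only: of_int_le_iff)
    then have le: "real n ^ 8 \<le> Z * s ^ 5 * L ^ 3"
      using card_sumset_lower_bound[OF M32] n2 by (simp add: Z_def s_def L_def n_def)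
    have N: "real n \<ge> 2" using n2 by (simp add: n_def)
    have L: "L \<ge> 1" using N by (simp add: L_def le_log_iff)
    have pw: "(x ^ k) powr (1/5) = x powr (real k / 5)" if "x > 0" for x :: real and k
      unfolding powr_realpow[OF that, symmetric] powr_powr by simp
    have "(real n ^ 8) powr (1/5) \<le> (Z * s ^ 5 * L ^ 3) powr (1/5)"
      using le by (intro powr_mono2) auto
    also have "(real n ^ 8) powr (1/5) = real n powr (8/5)"
      using pw[of "real n" 8] N by simp
    also have "(Z * s ^ 5 * L ^ 3) powr (1/5) = Z powr (1/5) * s * L powr (3/5)"
    proof -
      have "(L ^ 3) powr (1/5) = L powr (3/5)" using pw[of L 3] L by simp
      moreover have "(s ^ 5) powr (1/5) = s"
      proof (cases "s = 0")
        case False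
        then have "s > 0" by (simp add: s_def)
        then show ?thesis using pw[of s 5] by simp
      qed simp
      ultimately show ?thesis using Z L by (simp add: powr_mult s_def)
    qed
    finally have "real n powr (8/5) / L powr (3/5) \<le> Z powr (1/5) * s"
      using L by (simp add: divide_le_eq)
    then have "Z powr (- 1/5) * (real n powr (8/5) / L powr (3/5)) \<le> Z powr (- 1/5) * (Z powr (1/5) * s)"
      by (intro mult_left_mono) auto
    also have "\<dots> = s" using Z by (simp add: mult.assoc[symmetric] powr_add[symmetric])
    finally show "Z powr (- 1/5) * (real (card \<Gamma>) powr (8/5) / (log 2 (real (card \<Gamma>))) powr (3/5))
        \<le> real (card (\<Gamma> <+>\<^bsub>residue_ring (int p)\<^esub> \<Gamma>))"
      by (simp add: sumset_eq n_def L_def s_def)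
  qed
qed

end
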